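(* For each integer $q\ge3$ put $b^q_k=\sqrt{\frac{3k(q-k)}{q(q+1)}}$ for $0\le k\le q$, $\hat a^q_k=b^q_{k-1}-b^q_k$ for $1\le k\le q$, $\hat{\bf a}^q=(\hat a^q_1,\dots,\hat a^q_q)'$, $$\hat{\bf y}^q=\sqrt{\frac{q(q^2-1)}{12}}\,\frac{\hat{\bf a}^q}{\|\hat{\bf a}^q\|},\qquad \hat{\bf x}^q=\hat{\bf y}^q+\frac{q+1}{2}{\bf e}^q .$$ The maximal configurations $\{\hat{\bf y}^q\}$ and $\{\hat{\bf x}^q\}$ are asymptotically permutation-full (APF).
   Context: Superscripts $q$ on vectors are indices. ${\bf e}^q=(1,\dots,1)'\in\mathbb{R}^q$; $\|\cdot\|$ is the Euclidean norm. $\widetilde{\mathcal M}^{q-1}=\{{\bf v}\in\mathbb{R}^q : {\bf v}'{\bf e}^q=0\}$, and $\widetilde{\mathcal M}^{q-1}_{\le}$ is the set of ${\bf v}\in\widetilde{\mathcal M}^{q-1}$ with $v_1\le\cdots\le v_q$ (one has $\hat{\bf y}^q\in\widetilde{\mathcal M}^{q-1}_{\le}$). For ${\bf y}\in\mathbb{R}^q$, $\Pi({\bf y})=\{P{\bf y} : P \text{ a } q\times q \text{ permutation matrix}\}$. For $\rho>0$, $\widetilde{\mathcal S}^{q-2}_\rho=\{{\bf v}\in\widetilde{\mathcal M}^{q-1}:\|{\bf v}\|=\rho\}$, and $\widetilde{\bf U}^{q-2}_\rho$ is the uniform (normalized rotation-invariant) probability measure on it. A spherical cap in $\widetilde{\mathcal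 S}^{q-2}_\rho$ is a set $C({\bf w};t)=\{{\bf v}\in\widetilde{\mathcal S}^{q-2}_{\rho}:{\bf v}'{\bf w}>\rho^2t\}$ with ${\bf w}\in\widetilde{\mathcal S}^{q-2}_\rho$ and $-1\le t<1$. For a nonempty finite $N\subset\widetilde{\mathcal S}^{q-2}_\rho$, $L^{q-2}(N)=\sup\{\widetilde{\bf U}^{q-2}_\rho(C): C \text{ a spherical cap in }\widetilde{\mathcal S}^{q-2}_\rho,\ N\cap C=\emptyset\}$. A sequence of nonzero vectors $\{{\bf y}^q\in\widetilde{\mathcal M}^{q-1}_{\le}\}$ ($q$ varying) is APF if $\lim_{q\to\infty}L^{q-2}(\Pi({\bf y}^q))=0$. For a sequence ${\bf x}^q\in\mathbb{R}^q$ with ordered components $x^q_1\le\cdots\le x^q_q$ (not all equal), APF means the same property for its projections ${\bf x}^q-\left(\frac1q\sum_i x_i^q\right){\bf e}^q$ onto $\widetilde{\mathcal M}^{q-1}$. *)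

theory Defs
  imports "HOL-Analysis.Analysis" "HOL-Probability.Probability" "HOL-Combinatorics.Permutations"
begin

text \<open>
  Since the dimension varies inside the statement, vectors of $\mathbb{R}^q$ are the points of the
  library's \<^const>\<open>Euclidean_space\<close> q: functions from nat to real vanishing at all
  arguments \<open>\<ge> q\<close>.  Components are therefore numbered from 0: the component called
  $v_k$ on paper, for $1 \le k \le q$, is \<open>v (k - 1)\<close>.
\<close>

definition dot :: "nat \<Rightarrow> (nat \<Rightarrow> real) \<Rightarrow> (nat \<Rightarrow> real) \<Rightarrow> real" where
  "dot q v w = (\<Sum>i<q. v i * w i)"

definition vnorm :: "nat \<Rightarrow> (nat \<Rightarrow> real) \<Rightarrow> real" where
  "vnorm q v = L2_set v {..<q}"

definition evec :: "nat \<Rightarrow> nat \<Rightarrow> real" where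
  "evec q = (\<lambda>i. if i < q then 1 else 0)"

definition sorted_vec :: "nat \<Rightarrow> (nat \<Rightarrow> real) \<Rightarrow> bool" where
  "sorted_vec q v \<longleftrightarrow> (\<forall>i j. i \<le> j \<longrightarrow> j < q \<longrightarrow> v i \<le> v j)"

definition Mtilde :: "nat \<Rightarrow> (nat \<Rightarrow> real) set" where
  "Mtilde q = {v \<in> topspace (Euclidean_space q). dot q v (evec q) = 0}"

definition Mtilde_le :: "nat \<Rightarrow> (nat \<Rightarrow> real) set" where
  "Mtilde_le q = {v \<in> Mtilde q. sorted_vec q v}"

definition perm_orbit :: "nat \<Rightarrow> (nat \<Rightarrow> real) \<Rightarrow> (nat \<Rightarrow> real) set" where
  "perm_orbit q y = {y \<circ> p | p. p permutes {..<q}}"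

definition Stilde :: "nat \<Rightarrow> real \<Rightarrow> (nat \<Rightarrow> real) set" where
  "Stilde q \<rho> = {v \<in> Mtilde q. vnorm q v = \<rho>}"

text \<open>Linear isometries of the hyperplane; surjectivity is automatic in finite dimension.\<close>

definition hyperplane_isometry :: "nat \<Rightarrow> ((nat \<Rightarrow> real) \<Rightarrow> (nat \<Rightarrow> real)) \<Rightarrow> bool" where
  "hyperplane_isometry q T \<longleftrightarrow>
     (\<forall>v\<in>Mtilde q. T v \<in> Mtilde q \<and> vnorm q (T v) = vnorm q v) \<and>
     (\<forall>u\<in>Mtilde q. \<forall>v\<in>Mtilde q. \<forall>a b.
        T (\<lambda>i. a * u i + b * v i) = (\<lambda>i. a * T u i + b * T v i))"

text \<open>
  The unique rotation-invariant probability measure on the Borel sets of the sphere.  The Borel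
  sets of the product topology on functions from nat to real induce the usual ones on
  $\mathbb{R}^q$.
\<close>

definition uniform_sphere :: "nat \<Rightarrow> real \<Rightarrow> (nat \<Rightarrow> real) measure" where
  "uniform_sphere q \<rho> = (THE U. prob_space U \<and>
      sets U = sets (restrict_space borel (Stilde q \<rho>)) \<and>
      (\<forall>T. hyperplane_isometry q T \<longrightarrow>
        (\<forall>A\<in>sets U. emeasure U (T ` A) = emeasure U A)))"

definition cap :: "nat \<Rightarrow> real \<Rightarrow> (nat \<Rightarrow> real) \<Rightarrow> real \<Rightarrow> (nat \<Rightarrow> real) set" where
  "cap q \<rho> w t = {v \<in> Stilde q \<rho>. dot q v w > \<rho>\<^sup>2 * t}"

definition spherical_caps :: "nat \<Rightarrow> real \<Rightarrow> (nat \<Rightarrow> real) set set" where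
  "spherical_caps q \<rho> = {cap q \<rho> w t | w t. w \<in> Stilde q \<rho> \<and> - 1 \<le> t \<and> t < 1}"

definition largest_empty_cap :: "nat \<Rightarrow> real \<Rightarrow> (nat \<Rightarrow> real) set \<Rightarrow> real" where
  "largest_empty_cap q \<rho> N =
     (SUP C \<in> {C \<in> spherical_caps q \<rho>. N \<inter> C = {}}. measure (uniform_sphere q \<rho>) C)"

text \<open>
  Sequences start at \<open>q = 3\<close>; values at smaller \<open>q\<close> are irrelevant.  The radius of the sphere
  containing the orbit of \<open>y q\<close> is the norm of \<open>y q\<close>.
\<close>

definition APF_centered :: "(nat \<Rightarrow> nat \<Rightarrow> real) \<Rightarrow> bool" where
  "APF_centered y \<longleftrightarrow>
     (\<forall>q\<ge>3. y q \<in> Mtilde_le q \<and> y q \<noteq> (\<lambda>i. 0)) \<and>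
     (\<lambda>q. largest_empty_cap q (vnorm q (y q)) (perm_orbit q (y q))) \<longlonglongrightarrow> 0"

definition center :: "nat \<Rightarrow> (nat \<Rightarrow> real) \<Rightarrow> nat \<Rightarrow> real" where
  "center q x = (\<lambda>i. x i - (\<Sum>j<q. x j) / real q * evec q i)"

definition APF :: "(nat \<Rightarrow> nat \<Rightarrow> real) \<Rightarrow> bool" where
  "APF x \<longleftrightarrow>
     (\<forall>q\<ge>3. x q \<in> topspace (Euclidean_space q) \<and> sorted_vec q (x q) \<and>
             (\<exists>i<q. \<exists>j<q. x q i \<noteq> x q j)) \<and>
     APF_centered (\<lambda>q. center q (x q))"

definition b_coeff :: "nat \<Rightarrow> nat \<Rightarrow> real" where
  "b_coeff q k = sqrt (3 * real k * (real q - real k) / (real q * (real q + 1)))"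

definition a_coeff :: "nat \<Rightarrow> nat \<Rightarrow> real" where
  "a_coeff q k = b_coeff q (k - 1) - b_coeff q k"

definition a_hat :: "nat \<Rightarrow> nat \<Rightarrow> real" where
  "a_hat q = (\<lambda>i. if i < q then a_coeff q (i + 1) else 0)"

definition y_hat :: "nat \<Rightarrow> nat \<Rightarrow> real" where
  "y_hat q = (\<lambda>i. sqrt (real q * ((real q)\<^sup>2 - 1) / 12) * (a_hat q i / vnorm q (a_hat q)))"

definition x_hat :: "nat \<Rightarrow> nat \<Rightarrow> real" where
  "x_hat q = (\<lambda>i. y_hat q i + (real q + 1) / 2 * evec q i)"

end

theory Submission
  imports Defs "HOL-Real_Asymp.Real_Asymp"
begin

text \<open>
  Every vector \<open>w\<close> of the hyperplane has a sorted rearrangement, which is a nonnegative combination of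
  step vectors. The vector \<open>a\<close> makes the same angle with all of them (its tail sums are the \<open>b\<^sub>k\<close>), so
  some point of the orbit of \<open>y\<close> has an inner product with \<open>w\<close> of at least
  \<open>sqrt (3 / (q + 1)) / \<parallel>a\<parallel>\<close> times \<open>\<parallel>y\<parallel> \<parallel>w\<parallel>\<close>. On a cap centred at \<open>w\<close> that misses the
  orbit, \<open>v \<bullet> w\<close> is therefore at least that large; since \<open>v \<bullet> w\<close> has second moment \<open>\<parallel>v\<parallel>\<^sup>2 \<parallel>w\<parallel>\<^sup>2 / (q - 1)\<close> under the
  uniform measure, Chebyshev's inequality bounds its measure by \<open>(q + 1) \<parallel>a\<parallel>\<^sup>2 / (3 (q - 1))\<close>. This
  tends to \<open>0\<close> because \<open>\<parallel>a\<parallel>\<^sup>2 = O(1 / sqrt q)\<close>. The uniform measure is obtained by normalising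
  Lebesgue measure on the ball of \<open>\<real>\<^sup>q\<close> after projection to the hyperplane.
\<close>

section \<open>The hyperplane and its reflections\<close>

text \<open>The choice of \<open>b_coeff\<close> comes from the centred step vectors: the indicator
  of the last \<open>q - k\<close> coordinates, projected to the hyperplane, has norm
  \<open>sqrt (k * (q - k) / q)\<close>, and its inner product with \<open>a_hat q\<close> is the
  tail sum \<open>b_coeff q k\<close>. The quotient is \<open>sqrt (3 / (q + 1))\<close> for every
  \<open>k\<close> with 0 < k < q, and this lower bound passes to nonnegative combinations. The
  obstacle is the measure. \<open>uniform_sphere\<close> is a definite description, so nothing is
  known about it until an invariant measure has been shown to exist and to be unique. Second moments
  and uniqueness rest on reflections alone, since one reflection already carries any point of the
  sphere to any other. Existence has to deal with all isometries of the hyperplane, hence with the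
  invariance of Lebesgue measure under orthogonal maps, which is derived here from translation
  invariance.\<close>

lemma mem_Euclidean_space_iff: "v \<in> topspace (Euclidean_space q) \<longleftrightarrow> (\<forall>i\<ge>q. v i = 0)"
  by (auto simp: topspace_Euclidean_space)

lemma Mtilde_iff: "v \<in> Mtilde q \<longleftrightarrow> (\<forall>i\<ge>q. v i = 0) \<and> (\<Sum>i<q. v i) = 0"
  by (auto simp: Mtilde_def mem_Euclidean_space_iff dot_def evec_def)

lemma dot_self: "dot q v v = (vnorm q v)\<^sup>2"
  by (simp add: dot_def vnorm_def L2_set_def sum_nonneg power2_eq_square)

lemma dot_commute: "dot q v w = dot q w v"
  by (simp add: dot_def mult.commute)

lemma dot_self_nonneg: "0 \<le> dot q v v"
  by (simp add: dot_self)

lemma vnorm_nonneg: "0 \<le> vnorm q v"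
  by (simp add: vnorm_def)

lemma vnorm_eq_iff: "vnorm q v = vnorm q w \<longleftrightarrow> dot q v v = dot q w w"
  by (simp add: dot_self vnorm_nonneg)

lemma Stilde_iff: "0 < \<rho> \<Longrightarrow> v \<in> Stilde q \<rho> \<longleftrightarrow> v \<in> Mtilde q \<and> dot q v v = \<rho>\<^sup>2"
  by (auto simp: Stilde_def dot_self vnorm_nonneg)

lemma dot_lin_left: "dot q (\<lambda>i. a * u i + b * v i) w = a * dot q u w + b * dot q v w"
  by (simp add: dot_def sum.distrib sum_distrib_left algebra_simps)

lemma dot_lin_right: "dot q w (\<lambda>i. a * u i + b * v i) = a * dot q w u + b * dot q w v"
  by (simp add: dot_def sum.distrib sum_distrib_left algebra_simps)

lemma dot_diff_left: "dot q (\<lambda>i. u i - v i) w = dot q u w - dot q v w"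
  using dot_lin_left[of q 1 u "-1" v w] by simp

lemma dot_diff_right: "dot q w (\<lambda>i. u i - v i) = dot q w u - dot q w v"
  using dot_lin_right[of q w 1 u "-1" v] by simp

lemma dot_add_left: "dot q (\<lambda>i. u i + v i) w = dot q u w + dot q v w"
  using dot_lin_left[of q 1 u "1" v w] by simp

lemma dot_add_right: "dot q w (\<lambda>i. u i + v i) = dot q w u + dot q w v"
  using dot_lin_right[of q w 1 u "1" v] by simp

lemma dot_scale_left: "dot q (\<lambda>i. a * u i) w = a * dot q u w"
  using dot_lin_left[of q a u 0 u w] by simp

lemma dot_scale_right: "dot q w (\<lambda>i. a * u i) = a * dot q w u"
  using dot_lin_right[of q w a u 0 u] by simp

lemmas dot_simps = dot_diff_left dot_diff_right dot_add_left dot_add_right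
  dot_scale_left dot_scale_right

lemma dot_self_eq_0: "dot q v v = 0 \<longleftrightarrow> (\<forall>i<q. v i = 0)"
  by (auto simp: dot_def sum_nonneg_eq_0_iff)

text \<open>Absorbs directions of length zero: division by zero yields 0 in
  \<open>reflection\<close>, and identities such as \<open>c * dot q a a = 2 * dot q u a\<close>
  survive because both sides are 0.\<close>

lemma dot_eq_0_if_self: "dot q a a = 0 \<Longrightarrow> dot q v a = 0"
  unfolding dot_self_eq_0 by (simp add: dot_def)

lemma Mtilde_lin: "u \<in> Mtilde q \<Longrightarrow> v \<in> Mtilde q \<Longrightarrow> (\<lambda>i. a * u i + b * v i) \<in> Mtilde q"
  by (simp add: Mtilde_iff sum.distrib flip: sum_distrib_left)

lemma Mtilde_diff: "u \<in> Mtilde q \<Longrightarrow> v \<in> Mtilde q \<Longrightarrow> (\<lambda>i. u i - v i) \<in> Mtilde q"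
  using Mtilde_lin[of u q v 1 "-1"] by simp

text \<open>Polarisation: \<open>hyperplane_isometry\<close> speaks of norms only, and expanding the
  norm of u + v recovers the inner product.\<close>

lemma isometry_dot:
  assumes T: "hyperplane_isometry q T" and u: "u \<in> Mtilde q" and v: "v \<in> Mtilde q"
  shows "dot q (T u) (T v) = dot q u v"
proof -
  have "vnorm q (T (\<lambda>i. 1 * u i + 1 * v i)) = vnorm q (\<lambda>i. 1 * u i + 1 * v i)"
    using T Mtilde_lin[OF u v, of 1 1] unfolding hyperplane_isometry_def by blast
  moreover have "T (\<lambda>i. 1 * u i + 1 * v i) = (\<lambda>i. 1 * T u i + 1 * T v i)"
    using T u v unfolding hyperplane_isometry_def by blast
  ultimately have "dot q (\<lambda>i. T u i + T v i) (\<lambda>i. T u i + T v i) = dot q (\<lambda>i. u i + v i) (\<lambda>i. u i + v i)"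
    by (simp add: vnorm_eq_iff)
  moreover have "dot q (T u) (T u) = dot q u u" "dot q (T v) (T v) = dot q v v"
    using T u v unfolding hyperplane_isometry_def by (auto simp: dot_self)
  ultimately show ?thesis
    by (simp add: dot_simps dot_commute)
qed

text \<open>If \<open>dot q a a = 0\<close>, the quotient is 0 and the map is the identity.\<close>

definition reflection :: "nat \<Rightarrow> (nat \<Rightarrow> real) \<Rightarrow> (nat \<Rightarrow> real) \<Rightarrow> (nat \<Rightarrow> real)" where
  "reflection q a v = (\<lambda>i. v i - 2 * dot q v a / dot q a a * a i)"

lemma dot_reflection:
  "dot q (reflection q a u) (reflection q a v) = dot q u v"
proof -
  define c where "c = 2 * dot q u a / dot q a a"
  define d where "d = 2 * dot q v a / dot q a a"
  have cd: "c * dot q a a = 2 * dot q u a" "d * dot q a a = 2 * dot q v a"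
    unfolding c_def d_def using dot_eq_0_if_self[of q a] by auto
  have "dot q (reflection q a u) (reflection q a v)
      = dot q u v - d * dot q u a - c * (dot q v a - d * dot q a a)"
    unfolding reflection_def c_def[symmetric] d_def[symmetric]
    by (simp only: dot_simps) (simp add: algebra_simps dot_commute[of q a v])
  also have "\<dots> = dot q u v - d * dot q u a + c * dot q v a"
    by (simp add: cd)
  also have "d * dot q u a = c * dot q v a"
    by (simp add: c_def d_def)
  finally show ?thesis by simp
qed

lemma reflection_involution: "reflection q a (reflection q a v) = v"
proof -
  define d where "d = 2 * dot q v a / dot q a a"
  have cd: "d * dot q a a = 2 * dot q v a"
    unfolding d_def using dot_eq_0_if_self[of q a] by auto
  have v: "reflection q a v = (\<lambda>i. v i - d * a i)"
    by (simp add: reflection_def d_def)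
  have "2 * dot q (\<lambda>i. v i - d * a i) a / dot q a a = - d"
    by (simp only: dot_simps cd) (simp add: d_def)
  then show ?thesis
    unfolding v reflection_def[of q a "\<lambda>i. v i - d * a i"] by simp
qed

lemma reflection_Mtilde: "a \<in> Mtilde q \<Longrightarrow> v \<in> Mtilde q \<Longrightarrow> reflection q a v \<in> Mtilde q"
  using Mtilde_lin[of v q a 1 "- (2 * dot q v a / dot q a a)"] by (simp add: reflection_def)

lemma reflection_isometry:
  assumes "a \<in> Mtilde q" shows "hyperplane_isometry q (reflection q a)"
proof -
  have "reflection q a (\<lambda>i. s * u i + t * v i) = (\<lambda>i. s * reflection q a u i + t * reflection q a v i)"
    for s t u v
    by (auto simp: reflection_def dot_lin_left add_divide_distrib algebra_simps)
  then show ?thesis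
    using assms by (auto simp: hyperplane_isometry_def reflection_Mtilde vnorm_eq_iff dot_reflection)
qed

text \<open>For vectors of equal norm, twice the inner product of u with u - w is the squared norm
  of u - w, so the coefficient in the reflection is 1. This is the transitivity on spheres that all
  later symmetry arguments use.\<close>

lemma reflection_swap:
  assumes eq: "dot q u u = dot q w w" and "u \<in> Mtilde q" "w \<in> Mtilde q"
  shows "reflection q (\<lambda>i. u i - w i) u = w"
proof (cases "dot q (\<lambda>i. u i - w i) (\<lambda>i. u i - w i) = 0")
  case True
  then have "\<forall>i<q. u i - w i = 0" unfolding dot_self_eq_0 .
  then have "u i = w i" for i using assms by (cases "i < q") (auto simp: Mtilde_iff)
  then show ?thesis by (auto simp: reflection_def dot_def)
next
  case False
  have "2 * dot q u (\<lambda>i. u i - w i) = dot q (\<lambda>i. u i - w i) (\<lambda>i. u i - w i)"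
    using eq by (simp add: dot_simps dot_commute)
  then have "2 * dot q u (\<lambda>i. u i - w i) / dot q (\<lambda>i. u i - w i) (\<lambda>i. u i - w i) = 1"
    using False by simp
  then show ?thesis unfolding reflection_def by simp
qed

section \<open>Invariant probability measures on the sphere\<close>

text \<open>The predicate inside the definite description \<open>uniform_sphere\<close>, named so
  that existence and uniqueness can be treated separately.\<close>

definition invariant_prob :: "nat \<Rightarrow> real \<Rightarrow> (nat \<Rightarrow> real) measure \<Rightarrow> bool" where
  "invariant_prob q \<rho> U \<longleftrightarrow> prob_space U \<and>
      sets U = sets (restrict_space borel (Stilde q \<rho>)) \<and>
      (\<forall>T. hyperplane_isometry q T \<longrightarrow>
        (\<forall>A\<in>sets U. emeasure U (T ` A) = emeasure U A))"

lemma measurable_coord[measurable]: "(\<lambda>v :: nat \<Rightarrow> real. v i) \<in> borel_measurable borel"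
  by (intro borel_measurable_continuous_onI) (auto intro: continuous_on_product_coordinates)

lemma measurable_into_fun:
  fixes f :: "'a \<Rightarrow> nat \<Rightarrow> real"
  shows "(\<And>i. (\<lambda>x. f x i) \<in> borel_measurable M) \<Longrightarrow> f \<in> measurable M borel"
  by (rule measurable_coordinatewise_then_product)

lemma measurable_dot[measurable (raw)]:
  assumes [measurable]: "f \<in> measurable M borel" "g \<in> measurable M borel"
  shows "(\<lambda>x. dot q (f x) (g x)) \<in> borel_measurable M"
  unfolding dot_def by measurable

lemma measurable_reflection[measurable]: "reflection q a \<in> measurable borel borel"
  unfolding reflection_def by (rule measurable_into_fun) measurable

lemma Stilde_borel[measurable]:
  assumes "0 < \<rho>" shows "Stilde q \<rho> \<in> sets borel"
proof -
  have "Stilde q \<rho> = {v \<in> space borel. (\<forall>i\<in>{q..}. v i = 0) \<and> (\<Sum>i<q. v i) = 0 \<and> dot q v v = \<rho>\<^sup>2}"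
    using assms by (auto simp: Stilde_iff Mtilde_iff)
  also have "\<dots> \<in> sets borel" by measurable
  finally show ?thesis .
qed

lemma space_invariant_prob:
  assumes "invariant_prob q \<rho> U" shows "space U = Stilde q \<rho>"
proof -
  have "space U = space (restrict_space borel (Stilde q \<rho>))"
    using assms unfolding invariant_prob_def by (intro sets_eq_imp_space_eq) auto
  then show ?thesis by (simp add: space_restrict_space)
qed

lemma measurable_invariant_prob:
  assumes "invariant_prob q \<rho> U" "f \<in> measurable borel N" shows "f \<in> measurable U N"
proof -
  have "f \<in> measurable (restrict_space borel (Stilde q \<rho>)) N"
    using assms(2) by (rule measurable_restrict_space1)
  then show ?thesis
    using assms(1) measurable_cong_sets[of U "restrict_space borel (Stilde q \<rho>)" N N]
    unfolding invariant_prob_def by auto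
qed

text \<open>Invariance is postulated for images of sets. A reflection is an involution, so images
  are preimages and invariance becomes a statement about the pushforward measure, which change of
  variables in integrals requires.\<close>

lemma invariant_prob_distr:
  assumes U: "invariant_prob q \<rho> U" and a: "a \<in> Mtilde q" and \<rho>: "0 < \<rho>"
  shows "distr U U (reflection q a) = U"
    and "reflection q a \<in> measurable U U"
proof -
  have S: "reflection q a v \<in> Stilde q \<rho>" if "v \<in> Stilde q \<rho>" for v
    using that a by (auto simp: Stilde_iff[OF \<rho>] reflection_Mtilde dot_reflection)
  have setsU: "sets U = sets (restrict_space borel (Stilde q \<rho>))"
    using U by (auto simp: invariant_prob_def)
  have "reflection q a \<in> measurable U (restrict_space borel (Stilde q \<rho>))"
    using S by (intro measurable_restrict_space2 measurable_invariant_prob[OF U] measurable_reflection)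
      (auto simp: space_invariant_prob[OF U])
  then show meas: "reflection q a \<in> measurable U U"
    using measurable_cong_sets[OF refl setsU, of U] by auto
  show "distr U U (reflection q a) = U"
  proof (rule measure_eqI)
    fix A assume "A \<in> sets (distr U U (reflection q a))"
    then have A: "A \<in> sets U" by simp
    then have sub: "A \<subseteq> Stilde q \<rho>" using sets.sets_into_space space_invariant_prob[OF U] by blast
    have "reflection q a -` A \<inter> space U = reflection q a ` A"
      using sub S by (auto simp: space_invariant_prob[OF U] image_iff reflection_involution)
        (metis reflection_involution)
    then have "emeasure (distr U U (reflection q a)) A = emeasure U (reflection q a ` A)"
      using A meas by (simp add: emeasure_distr)
    also have "\<dots> = emeasure U A"
      using U A reflection_isometry[OF a] by (auto simp: invariant_prob_def)
    finally show "emeasure (distr U U (reflection q a)) A = emeasure U A" .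
  qed simp
qed

section \<open>Second moments under an invariant measure\<close>

lemma dot_Cauchy_Schwarz: "(dot q u v)\<^sup>2 \<le> dot q u u * dot q v v"
  using Cauchy_Schwarz_ineq_sum[of u v "{..<q}"] by (simp add: dot_def power2_eq_square)

lemma integrable_invariant_prob:
  assumes U: "invariant_prob q \<rho> U" and f: "f \<in> borel_measurable borel"
    and bound: "\<And>v. v \<in> Stilde q \<rho> \<Longrightarrow> \<bar>f v\<bar> \<le> c"
  shows "integrable U (f :: _ \<Rightarrow> real)"
proof -
  interpret prob_space U using U by (simp add: invariant_prob_def)
  show ?thesis
    using bound measurable_invariant_prob[OF U f]
    by (intro integrable_const_bound[of f c]) (auto simp: space_invariant_prob[OF U])
qed

lemma integrable_dot_square:
  assumes U: "invariant_prob q \<rho> U" and \<rho>: "0 < \<rho>"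
  shows "integrable U (\<lambda>v. (dot q v w)\<^sup>2)"
proof (rule integrable_invariant_prob[OF U])
  show "\<bar>(dot q v w)\<^sup>2\<bar> \<le> \<rho>\<^sup>2 * dot q w w" if "v \<in> Stilde q \<rho>" for v
    using that dot_Cauchy_Schwarz[of q v w] by (simp add: Stilde_iff[OF \<rho>])
qed measurable

lemma dot_reflection_swap: "dot q (reflection q a u) v = dot q u (reflection q a v)"
  using dot_reflection[of q a u "reflection q a v"] by (simp add: reflection_involution)

text \<open>The reflection that swaps \<open>w\<close> and \<open>w'\<close> is self-adjoint, so it
  can be moved from \<open>w\<close> onto \<open>v\<close>, where invariance of \<open>U\<close>
  removes it.\<close>

lemma second_moment_cong:
  assumes U: "invariant_prob q \<rho> U" and \<rho>: "0 < \<rho>"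
    and w: "w \<in> Mtilde q" "w' \<in> Mtilde q" "dot q w w = dot q w' w'"
  shows "(\<integral>v. (dot q v w)\<^sup>2 \<partial>U) = (\<integral>v. (dot q v w')\<^sup>2 \<partial>U)"
proof -
  define R where "R = reflection q (\<lambda>i. w i - w' i)"
  have a: "(\<lambda>i. w i - w' i) \<in> Mtilde q" using w by (simp add: Mtilde_diff)
  have Rw: "R w = w'"
    unfolding R_def using w by (intro reflection_swap) auto
  have "(\<integral>v. (dot q v w)\<^sup>2 \<partial>U) = (\<integral>v. (dot q v w)\<^sup>2 \<partial>(distr U U R))"
    unfolding R_def invariant_prob_distr(1)[OF U a \<rho>] ..
  also have "\<dots> = (\<integral>v. (dot q (R v) w)\<^sup>2 \<partial>U)"
    unfolding R_def
    by (intro integral_distr invariant_prob_distr(2)[OF U a \<rho>] measurable_invariant_prob[OF U]) measurable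
  also have "\<dots> = (\<integral>v. (dot q v w')\<^sup>2 \<partial>U)"
    using Rw by (simp add: R_def dot_reflection_swap)
  finally show ?thesis .
qed

text \<open>The left-hand side adds up the squared inner products of v with all differences of unit
  vectors. On the sphere the coordinate sum vanishes, so the right-hand side is constant
  there.\<close>

lemma sum_diff_squares:
  "(\<Sum>i<q. \<Sum>j<q. (v i - v j)\<^sup>2) = 2 * (real q * dot q v v - (\<Sum>i<q. v i)\<^sup>2)" for v :: "nat \<Rightarrow> real"
proof -
  have "(\<Sum>i<q. \<Sum>j<q. (v i - v j)\<^sup>2) = (\<Sum>i<q. \<Sum>j<q. v i * v i + v j * v j - 2 * (v i * v j))"
    by (intro sum.cong refl) (simp add: power2_eq_square algebra_simps)
  also have "\<dots> = 2 * (real q * dot q v v) - 2 * ((\<Sum>i<q. v i) * (\<Sum>i<q. v i))"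
    by (simp add: sum.distrib sum_subtractf dot_def sum_product flip: sum_distrib_left)
  finally show ?thesis by (simp add: power2_eq_square)
qed

text \<open>By reflection invariance the second moment of \<open>v \<bullet> w\<close> depends on \<open>w\<close> only through its norm,
  so it can be read off by summing over the directions \<open>e\<^sub>i - e\<^sub>j\<close>.\<close>

lemma second_moment:
  assumes U: "invariant_prob q \<rho> U" and \<rho>: "0 < \<rho>" and q: "2 \<le> q" and w: "w \<in> Mtilde q"
  shows "(\<integral>v. (dot q v w)\<^sup>2 \<partial>U) = \<rho>\<^sup>2 * dot q w w / (real q - 1)"
proof -
  interpret prob_space U using U by (simp add: invariant_prob_def)
  define d :: "nat \<Rightarrow> nat \<Rightarrow> nat \<Rightarrow> real"
    where "d i j = (\<lambda>k. (if k = i then 1 else 0) - (if k = j then 1 else 0))" for i j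
  define m where "m w = (\<integral>v. (dot q v w)\<^sup>2 \<partial>U)" for w
  \<comment> \<open>The differences \<open>d i j\<close> with i \<noteq> j have squared norm 2;
    scaling them by \<open>s\<close> gives them the norm of \<open>w\<close>.\<close>
  define s where "s = sqrt (dot q w w / 2)"
  have s2: "s\<^sup>2 = dot q w w / 2" by (simp add: s_def dot_self_nonneg)
  have dM: "d i j \<in> Mtilde q" if "i < q" "j < q" for i j
    using that by (auto simp: Mtilde_iff d_def sum_subtractf)
  have dotd: "dot q v (d i j) = v i - v j" if "i < q" "j < q" for i j v
  proof -
    have "dot q v (\<lambda>k. if k = i then 1 else 0) = v i" if "i < q" for i
      using that by (simp add: dot_def if_distrib[where f="(*) _"] cong: if_cong)
    then show ?thesis using that by (simp add: d_def dot_diff_right)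
  qed
  have m: "s\<^sup>2 * m (d i j) = m w" if "i < q" "j < q" "i \<noteq> j" for i j
  proof -
    have "dot q (d i j) (d i j) = 2"
      using that by (subst dotd) (auto simp: d_def)
    then have "dot q (\<lambda>k. s * d i j k) (\<lambda>k. s * d i j k) = dot q w w"
      using s2 by (simp add: dot_simps power2_eq_square)
    moreover have "(\<lambda>k. s * d i j k) \<in> Mtilde q"
      using dM[of i j] that by (simp add: Mtilde_iff flip: sum_distrib_left)
    ultimately have "m (\<lambda>k. s * d i j k) = m w"
      unfolding m_def by (intro second_moment_cong[OF U \<rho>] w)
    then show ?thesis
      by (simp add: m_def dot_simps power_mult_distrib)
  qed
  have m0: "m (d i i) = 0" for i by (simp add: m_def d_def dot_def)
  have "s\<^sup>2 * (\<Sum>i<q. \<Sum>j<q. m (d i j)) = (\<Sum>i<q. \<Sum>j<q. s\<^sup>2 * m (d i j))"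
    by (simp add: sum_distrib_left)
  also have "\<dots> = (\<Sum>i<q. \<Sum>j<q. if i = j then 0 else m w)"
    by (intro sum.cong refl) (simp add: m m0)
  also have "\<dots> = (\<Sum>i<q. \<Sum>j<q. m w - (if i = j then m w else 0))"
    by (intro sum.cong refl) auto
  also have "\<dots> = real q * (real q - 1) * m w"
    by (simp add: sum_subtractf algebra_simps)
  finally have 1: "s\<^sup>2 * (\<Sum>i<q. \<Sum>j<q. m (d i j)) = real q * (real q - 1) * m w" .
  have "(\<Sum>i<q. \<Sum>j<q. m (d i j)) = (\<integral>v. (\<Sum>i<q. \<Sum>j<q. (dot q v (d i j))\<^sup>2) \<partial>U)"
    by (simp add: m_def integrable_dot_square[OF U \<rho>])
  also have "\<dots> = (\<integral>v. 2 * (real q * \<rho>\<^sup>2) \<partial>U)"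
    by (intro Bochner_Integration.integral_cong refl)
      (simp add: dotd sum_diff_squares space_invariant_prob[OF U] Stilde_iff[OF \<rho>] Mtilde_iff)
  also have "\<dots> = 2 * (real q * \<rho>\<^sup>2)" by (simp add: prob_space)
  finally have "real q * (real q - 1) * m w = real q * (dot q w w * \<rho>\<^sup>2)"
    using 1 s2 by auto
  then have "(real q - 1) * m w = dot q w w * \<rho>\<^sup>2" using q by (auto simp: mult.assoc)
  then show ?thesis using q by (simp add: m_def field_simps)
qed

lemma measure_cap_le:
  assumes U: "invariant_prob q \<rho> U" and \<rho>: "0 < \<rho>" and q: "2 \<le> q" and w: "w \<in> Mtilde q"
    and c: "0 < c"
  shows "measure U {v \<in> Stilde q \<rho>. dot q v w > c} \<le> \<rho>\<^sup>2 * dot q w w / ((real q - 1) * c\<^sup>2)"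
proof -
  interpret prob_space U using U by (simp add: invariant_prob_def)
  have [measurable]: "(\<lambda>v. (dot q v w)\<^sup>2) \<in> borel_measurable U"
    by (rule measurable_invariant_prob[OF U]) measurable
  have "{v \<in> space U. (dot q v w)\<^sup>2 \<ge> c\<^sup>2} \<in> sets U" by measurable
  then have "measure U {v \<in> Stilde q \<rho>. dot q v w > c} \<le> measure U {v \<in> space U. (dot q v w)\<^sup>2 \<ge> c\<^sup>2}"
    using c by (intro finite_measure_mono) (auto simp: space_invariant_prob[OF U] intro: power_mono)
  also have "\<dots> \<le> (\<integral>v. (dot q v w)\<^sup>2 \<partial>U) / c\<^sup>2"
    by (rule integral_Markov_inequality_measure[OF integrable_dot_square[OF U \<rho>], of "space U"]) (use c in auto)
  finally show ?thesis by (simp add: second_moment[OF U \<rho> q w])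
qed

section \<open>Uniqueness of the invariant measure\<close>

text \<open>Indicator that the squared Euclidean distance of the first \<open>q\<close> coordinates
  is below \<open>r\<close>, so \<open>r\<close> is a squared radius. As a symmetric function of two
  points it can be integrated in either variable.\<close>

definition ball_kernel :: "nat \<Rightarrow> real \<Rightarrow> (nat \<Rightarrow> real) \<Rightarrow> (nat \<Rightarrow> real) \<Rightarrow> ennreal" where
  "ball_kernel q r v w = (if dot q (\<lambda>i. v i - w i) (\<lambda>i. v i - w i) < r then 1 else 0)"

lemma ball_kernel_commute: "ball_kernel q r v w = ball_kernel q r w v"
  by (simp add: ball_kernel_def dot_def algebra_simps)

lemma measurable_diff_fun[measurable (raw)]:
  fixes f g :: "'a \<Rightarrow> nat \<Rightarrow> real"
  assumes [measurable]: "f \<in> measurable M borel" "g \<in> measurable M borel"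
  shows "(\<lambda>x i. f x i - g x i) \<in> measurable M borel"
  by (rule measurable_into_fun) measurable

lemma measurable_ball_kernel[measurable (raw)]:
  assumes [measurable]: "f \<in> measurable M borel" "g \<in> measurable M borel"
  shows "(\<lambda>x. ball_kernel q r (f x) (g x)) \<in> borel_measurable M"
  unfolding ball_kernel_def by measurable

lemma sets_invariant_prob:
  "invariant_prob q \<rho> U \<Longrightarrow> sets U = sets (restrict_space borel (Stilde q \<rho>))"
  by (simp add: invariant_prob_def)

text \<open>The reflection that swaps the two centres preserves both distances and
  \<open>U\<close>.\<close>

lemma ball_mass_const:
  assumes U: "invariant_prob q \<rho> U" and \<rho>: "0 < \<rho>"
    and w: "w \<in> Stilde q \<rho>" "w' \<in> Stilde q \<rho>"
  shows "(\<integral>\<^sup>+v. ball_kernel q r v w \<partial>U) = (\<integral>\<^sup>+v. ball_kernel q r v w' \<partial>U)"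
proof -
  define R where "R = reflection q (\<lambda>i. w i - w' i)"
  have a: "(\<lambda>i. w i - w' i) \<in> Mtilde q" using w by (simp add: Mtilde_diff Stilde_iff[OF \<rho>])
  have Rw: "R w = w'"
    unfolding R_def using w by (intro reflection_swap) (auto simp: Stilde_iff[OF \<rho>])
  have "dot q (\<lambda>i. R v i - R w i) (\<lambda>i. R v i - R w i) = dot q (\<lambda>i. v i - w i) (\<lambda>i. v i - w i)" for v
    unfolding R_def by (simp only: dot_simps dot_reflection)
  then have dist: "dot q (\<lambda>i. R v i - w' i) (\<lambda>i. R v i - w' i) = dot q (\<lambda>i. v i - w i) (\<lambda>i. v i - w i)" for v
    by (simp only: Rw)
  have meas: "(\<lambda>v. ball_kernel q r v w') \<in> borel_measurable U"
    by (rule measurable_invariant_prob[OF U]) measurable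
  have "(\<integral>\<^sup>+v. ball_kernel q r v w' \<partial>U) = (\<integral>\<^sup>+v. ball_kernel q r v w' \<partial>(distr U U R))"
    unfolding R_def invariant_prob_distr(1)[OF U a \<rho>] ..
  also have "\<dots> = (\<integral>\<^sup>+v. ball_kernel q r (R v) w' \<partial>U)"
    unfolding R_def using invariant_prob_distr(2)[OF U a \<rho>] meas
    by (intro nn_integral_distr) simp_all
  also have "\<dots> = (\<integral>\<^sup>+v. ball_kernel q r v w \<partial>U)"
    by (simp add: dist ball_kernel_def)
  finally show ?thesis ..
qed

lemma tendsto_fun_iff:
  fixes f :: "nat \<Rightarrow> nat \<Rightarrow> real"
  shows "(f \<longlonglongrightarrow> l) \<longleftrightarrow> (\<forall>i. (\<lambda>n. f n i) \<longlonglongrightarrow> l i)"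
  unfolding limitin_canonical_iff[symmetric] euclidean_product_topology[symmetric]
  by (simp add: limitin_componentwise)

text \<open>Links the product topology, in which \<open>G\<close> is open, to the Euclidean
  distance. On the sphere all coordinates from \<open>q\<close> on are 0, so small Euclidean
  distance forces convergence of every coordinate; a sequence of counterexamples would converge to
  \<open>w\<close> while staying outside \<open>G\<close>.\<close>

lemma ball_kernel_open_nhd:
  assumes G: "open G" "w \<in> G" and w: "w \<in> Stilde q \<rho>"
  shows "\<forall>\<^sub>F n in sequentially. \<forall>v\<in>Stilde q \<rho>. ball_kernel q (1 / Suc n) v w \<noteq> 0 \<longrightarrow> v \<in> G"
proof (rule ccontr)
  assume "\<not> ?thesis"
  then have inf: "\<exists>\<^sub>F n in sequentially. \<exists>v\<in>Stilde q \<rho>. ball_kernel q (1 / Suc n) v w \<noteq> 0 \<and> v \<notin> G"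
    by (simp add: not_eventually)
  have "\<exists>v. v \<in> Stilde q \<rho> \<and> dot q (\<lambda>i. v i - w i) (\<lambda>i. v i - w i) < 1 / Suc n \<and> v \<notin> G" for n
  proof -
    from inf obtain m v where m: "m \<ge> n" "v \<in> Stilde q \<rho>" "ball_kernel q (1 / Suc m) v w \<noteq> 0" "v \<notin> G"
      unfolding frequently_sequentially by blast
    have "1 / real (Suc m) \<le> 1 / real (Suc n)" using m(1) by (simp add: field_simps)
    with m show ?thesis by (intro exI[of _ v]) (auto simp: ball_kernel_def split: if_splits)
  qed
  then obtain v where v: "\<And>n. v n \<in> Stilde q \<rho>" "\<And>n. v n \<notin> G"
    "\<And>n. dot q (\<lambda>i. v n i - w i) (\<lambda>i. v n i - w i) < 1 / Suc n"
    by metis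
  have "v \<longlonglongrightarrow> w"
    unfolding tendsto_fun_iff
  proof
    fix i show "(\<lambda>n. v n i) \<longlonglongrightarrow> w i"
    proof (cases "i < q")
      case True
      have "(v n i - w i)\<^sup>2 \<le> 1 / Suc n" for n
      proof -
        have "(v n i - w i)\<^sup>2 \<le> dot q (\<lambda>i. v n i - w i) (\<lambda>i. v n i - w i)"
          unfolding dot_def power2_eq_square using True
          by (intro member_le_sum[of i "{..<q}" "\<lambda>i. (v n i - w i) * (v n i - w i)"]) auto
        then show ?thesis using v(3)[of n] by linarith
      qed
      then have "\<forall>\<^sub>F n in sequentially. (v n i - w i)\<^sup>2 \<le> 1 / Suc n" by (intro always_eventually allI)
      then have "(\<lambda>n. (v n i - w i)\<^sup>2) \<longlonglongrightarrow> 0"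
        by (rule tendsto_sandwich[rotated, OF _ tendsto_const LIMSEQ_Suc[OF lim_const_over_n]]) simp
      from tendsto_real_sqrt[OF this] have "(\<lambda>n. \<bar>v n i - w i\<bar>) \<longlonglongrightarrow> 0" by simp
      then have "(\<lambda>n. v n i - w i) \<longlonglongrightarrow> 0" by (rule tendsto_rabs_zero_cancel)
      then show ?thesis by (simp add: LIM_zero_iff)
    next
      case False
      then have "v n i = w i" for n
        using v(1)[of n] w by (simp add: Stilde_def Mtilde_iff)
      then show ?thesis by simp
    qed
  qed
  then have "\<forall>\<^sub>F n in sequentially. v n \<in> G"
    using G by (rule topological_tendstoD)
  then show False using v(2) by simp
qed

text \<open>If one ball were null, all balls of that radius would be, and by Lindelof countably many
  of them cover the sphere, which has mass 1.\<close>

lemma ball_mass_pos: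
  assumes U: "invariant_prob q \<rho> U" and \<rho>: "0 < \<rho>" and w: "w \<in> Stilde q \<rho>" and r: "0 < r"
  shows "(\<integral>\<^sup>+v. ball_kernel q r v w \<partial>U) \<noteq> 0"
proof
  assume 0: "(\<integral>\<^sup>+v. ball_kernel q r v w \<partial>U) = 0"
  interpret prob_space U using U by (simp add: invariant_prob_def)
  define B where "B w = {v. dot q (\<lambda>i. v i - w i) (\<lambda>i. v i - w i) < r}" for w :: "nat \<Rightarrow> real"
  have op: "open (B w)" for w
    unfolding B_def dot_def
    by (intro open_Collect_less continuous_intros) (auto intro: continuous_on_product_coordinates)
  have null: "B w' \<inter> Stilde q \<rho> \<in> null_sets U" if w': "w' \<in> Stilde q \<rho>" for w'
  proof -
    have B: "B w' \<inter> Stilde q \<rho> \<in> sets U"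
      using op[of w'] unfolding sets_invariant_prob[OF U] sets_restrict_space by auto
    have "emeasure U (B w' \<inter> Stilde q \<rho>) = (\<integral>\<^sup>+v. indicator (B w' \<inter> Stilde q \<rho>) v \<partial>U)"
      using B by simp
    also have "\<dots> = (\<integral>\<^sup>+v. ball_kernel q r v w' \<partial>U)"
      by (intro nn_integral_cong) (auto simp: ball_kernel_def B_def space_invariant_prob[OF U] split: split_indicator)
    also have "\<dots> = 0" using ball_mass_const[OF U \<rho> w' w] 0 by simp
    finally show ?thesis using B by auto
  qed
  obtain F where F: "F \<subseteq> B ` Stilde q \<rho>" "countable F" "\<Union>F = \<Union>(B ` Stilde q \<rho>)"
    using Lindelof[of "B ` Stilde q \<rho>"] op by auto
  have "(\<Union>A\<in>F. A \<inter> Stilde q \<rho>) \<in> null_sets U"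
    using F null by (intro null_sets_UN') auto
  moreover have "(\<Union>A\<in>F. A \<inter> Stilde q \<rho>) = Stilde q \<rho>"
  proof -
    have "v \<in> B v" for v using r by (simp add: B_def dot_def)
    then have "Stilde q \<rho> \<subseteq> \<Union>F" unfolding F(3) by auto
    then show ?thesis by auto
  qed
  ultimately have "emeasure U (space U) = 0" by (simp add: space_invariant_prob[OF U] null_setsD1)
  then show False by (simp add: emeasure_space_1)
qed

text \<open>Fubini shows that balls of equal radius have the same mass under both measures; Fatou's lemma,
  applied to averages of the indicator over small balls, then compares open sets.\<close>

lemma invariant_prob_open_le:
  assumes U: "invariant_prob q \<rho> U" and V: "invariant_prob q \<rho> V" and \<rho>: "0 < \<rho>" and G: "open G"
  shows "emeasure V (G \<inter> Stilde q \<rho>) \<le> emeasure U (G \<inter> Stilde q \<rho>)"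
proof -
  interpret U: prob_space U using U by (simp add: invariant_prob_def)
  interpret V: prob_space V using V by (simp add: invariant_prob_def)
  interpret P: pair_prob_space U V ..
  define S where "S = Stilde q \<rho>"
  obtain w0 where w0: "w0 \<in> S" using U.not_empty space_invariant_prob[OF U] S_def by auto
  have spU: "space U = S" and spV: "space V = S"
    by (simp_all add: space_invariant_prob[OF U] space_invariant_prob[OF V] S_def)
  have [measurable]: "G \<in> sets borel" using G by simp
  have idU[measurable]: "(\<lambda>x. x) \<in> measurable U borel" and idV[measurable]: "(\<lambda>x. x) \<in> measurable V borel"
    by (rule measurable_invariant_prob[OF U], simp) (rule measurable_invariant_prob[OF V], simp)
  have [measurable]: "fst \<in> measurable (U \<Otimes>\<^sub>M V) borel" "snd \<in> measurable (U \<Otimes>\<^sub>M V) borel"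
    using measurable_compose[OF measurable_fst idU, of V] measurable_compose[OF measurable_snd idV, of U] by simp_all
  \<comment> \<open>The mass under \<open>V\<close> of any ball with squared radius
    \<open>r\<close>; \<open>hU\<close> shows that \<open>U\<close> gives the same value.\<close>
  define h where "h r = (\<integral>\<^sup>+v. ball_kernel q r v w0 \<partial>V)" for r
  have hV: "(\<integral>\<^sup>+w. ball_kernel q r v w \<partial>V) = h r" if "v \<in> S" for v r
    unfolding h_def using ball_mass_const[OF V \<rho>, of v w0 r] that w0
    by (simp add: S_def ball_kernel_commute[of q r v])
  have fub: "(\<integral>\<^sup>+w. (\<integral>\<^sup>+v. indicator A v * ball_kernel q r v w \<partial>U) \<partial>V) = h r * emeasure U (A \<inter> S)"
    if [measurable]: "A \<in> sets borel" for A r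
  proof -
    have A: "A \<inter> S \<in> sets U" unfolding sets_invariant_prob[OF U] sets_restrict_space S_def using that by auto
    have "(\<integral>\<^sup>+w. (\<integral>\<^sup>+v. indicator A v * ball_kernel q r v w \<partial>U) \<partial>V)
        = (\<integral>\<^sup>+v. (\<integral>\<^sup>+w. indicator A v * ball_kernel q r v w \<partial>V) \<partial>U)"
      by (intro P.Fubini') (simp add: case_prod_beta)
    also have "\<dots> = (\<integral>\<^sup>+v. h r * indicator (A \<inter> S) v \<partial>U)"
      by (intro nn_integral_cong) (auto simp: nn_integral_cmult hV spU mult.commute split: split_indicator)
    also have "\<dots> = h r * emeasure U (A \<inter> S)"
      using A by (simp add: nn_integral_cmult)
    finally show ?thesis .
  qed
  have hU: "(\<integral>\<^sup>+v. ball_kernel q r v w \<partial>U) = h r" if "w \<in> S" for w r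
  proof -
    \<comment> \<open>Fubini with the whole space in place of \<open>A\<close> compares the ball
      masses of the two probability measures.\<close>
    have "h r = h r * emeasure U (UNIV \<inter> S)" using U.emeasure_space_1 by (simp add: spU)
    also have "\<dots> = (\<integral>\<^sup>+w'. (\<integral>\<^sup>+v. ball_kernel q r v w' \<partial>U) \<partial>V)"
      by (subst fub[symmetric]) auto
    also have "\<dots> = (\<integral>\<^sup>+w'. (\<integral>\<^sup>+v. ball_kernel q r v w \<partial>U) \<partial>V)"
      using that by (intro nn_integral_cong ball_mass_const[OF U \<rho>]) (auto simp: spV S_def)
    also have "\<dots> = (\<integral>\<^sup>+v. ball_kernel q r v w \<partial>U)"
      by (simp add: V.emeasure_space_1)
    finally show ?thesis ..
  qed
  have h0: "h r \<noteq> 0" if "0 < r" for r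
    unfolding h_def using ball_mass_pos[OF V \<rho> _ that] w0 by (simp add: S_def)
  have htop: "h r \<noteq> \<top>" for r
  proof -
    have "h r \<le> (\<integral>\<^sup>+v. 1 \<partial>V)" unfolding h_def by (intro nn_integral_mono) (auto simp: ball_kernel_def)
    then show ?thesis by (auto simp: V.emeasure_space_1 top_unique)
  qed
  \<comment> \<open>The \<open>U\<close>-average of the indicator of \<open>G\<close> over a small
    ball around \<open>w\<close>. Its \<open>V\<close>-integral is the \<open>U\<close>-measure of
    \<open>G\<close> on the sphere for every \<open>n\<close>, while at a point of \<open>G\<close>
    it is eventually at least 1.\<close>
  define g where "g n w = (\<integral>\<^sup>+v. indicator G v * ball_kernel q (1 / Suc n) v w \<partial>U) / h (1 / Suc n)" for n w
  have meas_g: "g n \<in> borel_measurable V" for n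
    unfolding g_def by measurable
  have int_g: "(\<integral>\<^sup>+w. g n w \<partial>V) = emeasure U (G \<inter> S)" for n
  proof -
    have "(\<integral>\<^sup>+w. g n w \<partial>V) = (h (1 / Suc n) * emeasure U (G \<inter> S)) / h (1 / Suc n)"
      unfolding g_def by (subst nn_integral_divide) (measurable, simp add: fub)
    then show ?thesis using h0[of "1 / Suc n"] htop[of "1 / Suc n"]
      by (simp add: ennreal_mult_divide_eq mult.commute)
  qed
  have OS: "G \<inter> S \<in> sets V" unfolding sets_invariant_prob[OF V] sets_restrict_space S_def using G by auto
  have "emeasure V (G \<inter> S) = (\<integral>\<^sup>+w. indicator (G \<inter> S) w \<partial>V)"
    using OS by simp
  also have "\<dots> \<le> (\<integral>\<^sup>+w. liminf (\<lambda>n. g n w) \<partial>V)"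
  proof (intro nn_integral_mono)
    fix w assume "w \<in> space V"
    then have w: "w \<in> S" by (simp add: spV)
    show "indicator (G \<inter> S) w \<le> liminf (\<lambda>n. g n w)"
    proof (cases "w \<in> G")
      case True
      have "\<forall>\<^sub>F n in sequentially. 1 \<le> g n w"
        using ball_kernel_open_nhd[OF G True w[unfolded S_def]]
      proof eventually_elim
        case (elim n)
        have "(\<integral>\<^sup>+v. indicator G v * ball_kernel q (1 / Suc n) v w \<partial>U) = (\<integral>\<^sup>+v. ball_kernel q (1 / Suc n) v w \<partial>U)"
          using elim by (intro nn_integral_cong) (auto simp: spU S_def split: split_indicator)
        then show ?case using h0[of "1 / Suc n"] htop[of "1 / Suc n"]
          by (simp add: g_def hU[OF w] ennreal_divide_self less_top)
      qed
      then have "1 \<le> liminf (\<lambda>n. g n w)" by (intro Liminf_bounded)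
      then show ?thesis by (auto split: split_indicator)
    qed simp
  qed
  also have "\<dots> \<le> liminf (\<lambda>n. \<integral>\<^sup>+w. g n w \<partial>V)"
    by (rule nn_integral_liminf) (rule meas_g)
  also have "\<dots> = emeasure U (G \<inter> S)" by (simp add: int_g Liminf_const)
  finally show ?thesis by (simp add: S_def)
qed

text \<open>The comparison of open sets holds in both directions, and open sets are an
  intersection-stable generator of the Borel sets. Both measures are pushed to the space of all
  functions, where this generator lives.\<close>

lemma invariant_prob_unique:
  assumes U: "invariant_prob q \<rho> U" and V: "invariant_prob q \<rho> V" and \<rho>: "0 < \<rho>"
  shows "U = V"
proof -
  interpret U: prob_space U using U by (simp add: invariant_prob_def)
  interpret V: prob_space V using V by (simp add: invariant_prob_def)
  define S where "S = Stilde q \<rho>"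
  have idU: "(\<lambda>x. x) \<in> measurable U borel" and idV: "(\<lambda>x. x) \<in> measurable V borel"
    by (rule measurable_invariant_prob[OF U], simp) (rule measurable_invariant_prob[OF V], simp)
  have eU: "emeasure (distr U borel (\<lambda>x. x)) A = emeasure U (A \<inter> S)" if "A \<in> sets borel" for A
    using that by (simp add: emeasure_distr[OF idU] space_invariant_prob[OF U] S_def)
  have eV: "emeasure (distr V borel (\<lambda>x. x)) A = emeasure V (A \<inter> S)" if "A \<in> sets borel" for A
    using that by (simp add: emeasure_distr[OF idV] space_invariant_prob[OF V] S_def)
  have "distr U borel (\<lambda>x. x) = distr V borel (\<lambda>x. x)"
  proof (rule measure_eqI_generator_eq[where E="{A. open A}" and \<Omega>=UNIV and A="\<lambda>_. UNIV"])
    show "emeasure (distr U borel (\<lambda>x. x)) X = emeasure (distr V borel (\<lambda>x. x)) X" if "X \<in> {A. open A}" for X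
      using that invariant_prob_open_le[OF U V \<rho>, of X] invariant_prob_open_le[OF V U \<rho>, of X]
      by (simp add: eU eV S_def)
    show "emeasure (distr U borel (\<lambda>x. x)) UNIV \<noteq> \<infinity>"
      using U.emeasure_space_1 by (subst eU) (auto simp: space_invariant_prob[OF U] S_def)
  qed (auto simp: Int_stable_def sets_borel)
  note eq = this
  show ?thesis
  proof (rule measure_eqI)
    show "sets U = sets V" by (simp add: sets_invariant_prob[OF U] sets_invariant_prob[OF V])
    fix A assume "A \<in> sets U"
    then obtain A' where "A' \<in> sets borel" "A = A' \<inter> S"
      by (auto simp: sets_invariant_prob[OF U] sets_restrict_space S_def)
    then show "emeasure U A = emeasure V A" using eU[of A'] eV[of A'] eq by simp
  qed
qed

section \<open>Lebesgue measure and orthogonal maps\<close>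

text \<open>Lebesgue measure of \<real>^q. Points of the finite product are undefined outside the
  index set; extension by zero moves them into the encoding of
  \<open>Euclidean_space\<close>.\<close>

definition lborel_fun :: "nat \<Rightarrow> (nat \<Rightarrow> real) measure" where
  "lborel_fun q = distr (PiM {..<q} (\<lambda>_. lborel)) borel (\<lambda>x i. if i < q then x i else 0)"

lemma sets_lborel_fun[measurable_cong]: "sets (lborel_fun q) = sets borel"
  and space_lborel_fun[simp]: "space (lborel_fun q) = UNIV"
  by (simp_all add: lborel_fun_def)

lemma measurable_extend_zero:
  "(\<lambda>x i. if i < q then x i else 0) \<in> measurable (PiM {..<q} (\<lambda>_. lborel)) (borel :: (nat \<Rightarrow> real) measure)"
proof (rule measurable_into_fun)
  show "(\<lambda>x. if i < q then x i else 0) \<in> borel_measurable (PiM {..<q} (\<lambda>_. lborel :: real measure))" for i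
    by (cases "i < q") (auto intro!: measurable_component_singleton[of i "{..<q}" "\<lambda>_. lborel", simplified])
qed

interpretation lborel_prod: product_sigma_finite "\<lambda>_::nat. lborel :: real measure" ..

lemma emeasure_lborel_fun_box:
  assumes A[measurable]: "\<And>i. i < q \<Longrightarrow> A i \<in> sets borel"
  shows "emeasure (lborel_fun q) {v. \<forall>i<q. v i \<in> A i} = (\<Prod>i<q. emeasure lborel (A i))"
proof -
  have "{v \<in> space borel. \<forall>i\<in>{..<q}. v i \<in> A i} \<in> sets (borel :: (nat \<Rightarrow> real) measure)"
    by measurable
  then have "{v. \<forall>i<q. v i \<in> A i} \<in> sets (borel :: (nat \<Rightarrow> real) measure)"
    by (simp add: Ball_def)
  then have "emeasure (lborel_fun q) {v. \<forall>i<q. v i \<in> A i}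
      = emeasure (PiM {..<q} (\<lambda>_. lborel)) ((\<lambda>x i. if i < q then x i else 0) -` {v. \<forall>i<q. v i \<in> A i}
          \<inter> space (PiM {..<q} (\<lambda>_. lborel)))"
    unfolding lborel_fun_def by (rule emeasure_distr[OF measurable_extend_zero])
  also have "(\<lambda>x i. if i < q then x i else 0) -` {v. \<forall>i<q. v i \<in> A i} \<inter> space (PiM {..<q} (\<lambda>_. lborel))
      = Pi\<^sub>E {..<q} A"
    by (auto simp: space_PiM PiE_def Pi_iff)
  also have "emeasure (PiM {..<q} (\<lambda>_. lborel)) (Pi\<^sub>E {..<q} A) = (\<Prod>i<q. emeasure lborel (A i))"
    using A by (intro lborel_prod.emeasure_PiM) auto
  finally show ?thesis .
qed

lemma measurable_support_set[measurable]: "{v. \<forall>i\<ge>q. v i = 0} \<in> sets (borel :: (nat \<Rightarrow> real) measure)"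
proof -
  have "{v \<in> space borel. \<forall>i\<in>{q..}. v i = 0} \<in> sets (borel :: (nat \<Rightarrow> real) measure)"
    by measurable
  then show ?thesis by (simp add: Ball_def)
qed

lemma AE_lborel_fun: "AE v in lborel_fun q. \<forall>i\<ge>q. v i = 0"
  using measurable_support_set[of q]
  unfolding lborel_fun_def by (subst AE_distr_iff[OF measurable_extend_zero]) auto

lemma measurable_add_fun[measurable (raw)]:
  fixes f g :: "'a \<Rightarrow> nat \<Rightarrow> real"
  assumes [measurable]: "f \<in> measurable M borel" "g \<in> measurable M borel"
  shows "(\<lambda>x i. f x i + g x i) \<in> measurable M borel"
  by (rule measurable_into_fun) measurable

lemma lborel_fun_translate:
  assumes a: "\<And>i. i \<ge> q \<Longrightarrow> a i = 0"
  shows "distr (lborel_fun q) borel (\<lambda>v i. v i + a i) = lborel_fun q"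
proof -
  define N where "N = PiM {..<q} (\<lambda>_. lborel :: real measure)"
  define e where "e = (\<lambda>(x :: nat \<Rightarrow> real) i. if i < q then x i else 0)"
  define t where "t = (\<lambda>x. \<lambda>i\<in>{..<q}. x i + a i)"
  have e: "e \<in> measurable N borel" unfolding e_def N_def by (rule measurable_extend_zero)
  have t: "t \<in> measurable N N" unfolding t_def N_def
    by (intro measurable_restrict) (auto intro!: borel_measurable_add measurable_component_singleton[of _ "{..<q}" "\<lambda>_. lborel", simplified])
  have "distr N N t = N"
    unfolding N_def
  proof (rule lborel_prod.PiM_eqI)
    fix A :: "nat \<Rightarrow> real set" assume A: "\<And>i. i \<in> {..<q} \<Longrightarrow> A i \<in> sets lborel"
    have pre: "{x. x + a i \<in> A i} \<in> sets borel" "emeasure lborel {x. x + a i \<in> A i} = emeasure lborel (A i)" if "i < q" for i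
    proof -
      have m: "(\<lambda>x. x + a i) \<in> measurable borel borel" by measurable
      have Ai: "A i \<in> sets borel" using A that by simp
      show "{x. x + a i \<in> A i} \<in> sets borel"
        using measurable_sets[OF m Ai] by (simp add: vimage_def)
      have "emeasure lborel (A i) = emeasure (distr lborel borel (\<lambda>x. a i + x)) (A i)"
        using lborel_distr_plus[of "a i"] by simp
      also have "\<dots> = emeasure lborel {x. x + a i \<in> A i}"
        using Ai by (subst emeasure_distr) (auto simp: vimage_def add.commute)
      finally show "emeasure lborel {x. x + a i \<in> A i} = emeasure lborel (A i)" ..
    qed
    have "Pi\<^sub>E {..<q} A \<in> sets N" using A unfolding N_def by (intro sets_PiM_I_finite) auto
    then have "emeasure (distr N N t) (Pi\<^sub>E {..<q} A) = emeasure N (t -` Pi\<^sub>E {..<q} A \<inter> space N)"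
      using t by (rule emeasure_distr[rotated])
    also have "t -` Pi\<^sub>E {..<q} A \<inter> space N = Pi\<^sub>E {..<q} (\<lambda>i. {x. x + a i \<in> A i})"
      by (auto simp: N_def t_def space_PiM PiE_def Pi_iff)
    also have "emeasure N \<dots> = (\<Prod>i<q. emeasure lborel {x. x + a i \<in> A i})"
      unfolding N_def using pre by (intro lborel_prod.emeasure_PiM) auto
    also have "\<dots> = (\<Prod>i<q. emeasure lborel (A i))"
      by (intro prod.cong) (auto simp: pre)
    finally show "emeasure (distr (PiM {..<q} (\<lambda>_. lborel)) (PiM {..<q} (\<lambda>_. lborel)) t) (Pi\<^sub>E {..<q} A)
        = (\<Prod>i<q. emeasure lborel (A i))" by (simp add: N_def)
  qed simp_all
  note dt = this
  have tr: "(\<lambda>v i. v i + a i) \<in> measurable borel (borel :: (nat \<Rightarrow> real) measure)" by measurable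
  have L: "lborel_fun q = distr N borel e" by (simp add: lborel_fun_def N_def e_def)
  have "distr (lborel_fun q) borel (\<lambda>v i. v i + a i) = distr N borel ((\<lambda>v i. v i + a i) \<circ> e)"
    unfolding L by (rule distr_distr[OF tr e])
  \<comment> \<open>Shifting and extending by zero commute because \<open>a\<close> vanishes from
    \<open>q\<close> on.\<close>
  also have "(\<lambda>v i. v i + a i) \<circ> e = e \<circ> t"
    using a by (auto simp: e_def t_def fun_eq_iff)
  also have "distr N borel (e \<circ> t) = distr (distr N N t) borel e"
    by (rule distr_distr[OF e t, symmetric])
  finally show ?thesis by (simp add: dt L)
qed

text \<open>Both sides evaluate the double integral of \<open>1\<^sub>A(x) 1\<^sub>B(y - x)\<close>.\<close>

lemma translation_invariant_swap:
  fixes \<mu> \<nu> :: "(nat \<Rightarrow> real) measure"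
  assumes sets[measurable_cong]: "sets \<mu> = sets borel" "sets \<nu> = sets borel"
    and fin: "sigma_finite_measure \<mu>" "sigma_finite_measure \<nu>"
    and AE: "AE x in \<mu>. \<forall>i\<ge>q. x i = 0" "AE x in \<nu>. \<forall>i\<ge>q. x i = 0"
    and inv: "\<And>a. (\<And>i. i \<ge> q \<Longrightarrow> a i = 0) \<Longrightarrow> distr \<mu> borel (\<lambda>v i. v i + a i) = \<mu>"
      "\<And>a. (\<And>i. i \<ge> q \<Longrightarrow> a i = 0) \<Longrightarrow> distr \<nu> borel (\<lambda>v i. v i + a i) = \<nu>"
    and A[measurable]: "A \<in> sets borel" and B[measurable]: "B \<in> sets borel"
    and sym: "\<And>v. (\<lambda>i. - v i) \<in> B \<longleftrightarrow> v \<in> B"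
  shows "emeasure \<mu> A * emeasure \<nu> B = emeasure \<nu> A * emeasure \<mu> B"
proof -
  interpret M: sigma_finite_measure \<mu> by fact
  interpret N: sigma_finite_measure \<nu> by fact
  interpret P: pair_sigma_finite \<mu> \<nu> ..
  have shift: "(\<integral>\<^sup>+v. f v \<partial>\<mu>) = (\<integral>\<^sup>+v. f (\<lambda>i. v i + a i) \<partial>\<mu>)"
    if f: "f \<in> borel_measurable borel" and a: "\<And>i. i \<ge> q \<Longrightarrow> a i = 0" for f :: "_ \<Rightarrow> ennreal" and a
  proof -
    have "(\<integral>\<^sup>+v. f v \<partial>\<mu>) = (\<integral>\<^sup>+v. f v \<partial>distr \<mu> borel (\<lambda>v i. v i + a i))" by (simp add: inv(1)[OF a])
    also have "\<dots> = (\<integral>\<^sup>+v. f (\<lambda>i. v i + a i) \<partial>\<mu>)"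
      using f by (intro nn_integral_distr) auto
    finally show ?thesis .
  qed
  have shift': "(\<integral>\<^sup>+v. f v \<partial>\<nu>) = (\<integral>\<^sup>+v. f (\<lambda>i. v i + a i) \<partial>\<nu>)"
    if f: "f \<in> borel_measurable borel" and a: "\<And>i. i \<ge> q \<Longrightarrow> a i = 0" for f :: "_ \<Rightarrow> ennreal" and a
  proof -
    have "(\<integral>\<^sup>+v. f v \<partial>\<nu>) = (\<integral>\<^sup>+v. f v \<partial>distr \<nu> borel (\<lambda>v i. v i + a i))" by (simp add: inv(2)[OF a])
    also have "\<dots> = (\<integral>\<^sup>+v. f (\<lambda>i. v i + a i) \<partial>\<nu>)"
      using f by (intro nn_integral_distr) auto
    finally show ?thesis .
  qed
  let ?I = "indicator :: (nat \<Rightarrow> real) set \<Rightarrow> (nat \<Rightarrow> real) \<Rightarrow> ennreal"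
  have ind[measurable]: "(\<lambda>x. ?I C (f x)) \<in> borel_measurable M"
    if "f \<in> measurable M borel" "C \<in> sets borel" for f M C
    using measurable_compose[OF that(1) borel_measurable_indicator[OF that(2)]] .
  \<comment> \<open>Shifting \<open>y\<close> by \<open>x\<close> removes \<open>x\<close> from the
    argument of \<open>B\<close>.\<close>
  have inner1: "(\<integral>\<^sup>+y. ?I A x * ?I B (\<lambda>i. y i - x i) \<partial>\<nu>) = ?I A x * emeasure \<nu> B"
    if x: "\<forall>i\<ge>q. x i = 0" for x
  proof -
    have "(\<integral>\<^sup>+y. ?I B (\<lambda>i. y i - x i) \<partial>\<nu>) = (\<integral>\<^sup>+y. ?I B (\<lambda>i. (y i + x i) - x i) \<partial>\<nu>)"
      using x by (intro shift'[where f="\<lambda>y. ?I B (\<lambda>i. y i - x i)"] ind) auto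
    then show ?thesis by (simp add: nn_integral_cmult sets)
  qed
  have inner2: "(\<integral>\<^sup>+x. ?I A x * ?I B (\<lambda>i. y i - x i) \<partial>\<mu>) = (\<integral>\<^sup>+x. ?I A (\<lambda>i. x i + y i) * ?I B x \<partial>\<mu>)"
    if y: "\<forall>i\<ge>q. y i = 0" for y
  proof -
    have "(\<integral>\<^sup>+x. ?I A x * ?I B (\<lambda>i. y i - x i) \<partial>\<mu>)
        = (\<integral>\<^sup>+x. ?I A (\<lambda>i. x i + y i) * ?I B (\<lambda>i. y i - (x i + y i)) \<partial>\<mu>)"
      using y by (intro shift[where f="\<lambda>x. ?I A x * ?I B (\<lambda>i. y i - x i)"] borel_measurable_times ind) auto
    \<comment> \<open>After the shift the argument of \<open>B\<close> is the negative of
      \<open>x\<close>; the symmetry of \<open>B\<close> turns it into \<open>x\<close>.\<close>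
    also have "\<dots> = (\<integral>\<^sup>+x. ?I A (\<lambda>i. x i + y i) * ?I B x \<partial>\<mu>)"
      using sym by (intro nn_integral_cong) (simp add: indicator_def)
    finally show ?thesis .
  qed
  have inner3: "(\<integral>\<^sup>+y. ?I A (\<lambda>i. x i + y i) * ?I B x \<partial>\<nu>) = emeasure \<nu> A * ?I B x"
    if x: "\<forall>i\<ge>q. x i = 0" for x
  proof -
    have "(\<integral>\<^sup>+y. ?I A y \<partial>\<nu>) = (\<integral>\<^sup>+y. ?I A (\<lambda>i. y i + x i) \<partial>\<nu>)"
      using x by (intro shift'[where f="?I A"]) auto
    then have "(\<integral>\<^sup>+y. ?I A (\<lambda>i. x i + y i) \<partial>\<nu>) = emeasure \<nu> A" by (simp add: add.commute sets)
    then show ?thesis by (simp add: nn_integral_multc sets)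
  qed
  have "emeasure \<mu> A * emeasure \<nu> B = (\<integral>\<^sup>+x. ?I A x * emeasure \<nu> B \<partial>\<mu>)"
    by (simp add: nn_integral_multc sets)
  also have "\<dots> = (\<integral>\<^sup>+x. (\<integral>\<^sup>+y. ?I A x * ?I B (\<lambda>i. y i - x i) \<partial>\<nu>) \<partial>\<mu>)"
    using AE(1) by (intro nn_integral_cong_AE) (auto simp: inner1)
  also have "\<dots> = (\<integral>\<^sup>+y. (\<integral>\<^sup>+x. ?I A x * ?I B (\<lambda>i. y i - x i) \<partial>\<mu>) \<partial>\<nu>)"
    by (intro P.Fubini'[symmetric]) (simp add: case_prod_beta)
  also have "\<dots> = (\<integral>\<^sup>+y. (\<integral>\<^sup>+x. ?I A (\<lambda>i. x i + y i) * ?I B x \<partial>\<mu>) \<partial>\<nu>)"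
    using AE(2) by (intro nn_integral_cong_AE) (auto simp: inner2)
  also have "\<dots> = (\<integral>\<^sup>+x. (\<integral>\<^sup>+y. ?I A (\<lambda>i. x i + y i) * ?I B x \<partial>\<nu>) \<partial>\<mu>)"
    by (intro P.Fubini') (simp add: case_prod_beta)
  also have "\<dots> = (\<integral>\<^sup>+x. emeasure \<nu> A * ?I B x \<partial>\<mu>)"
    using AE(1) by (intro nn_integral_cong_AE) (auto simp: inner3)
  also have "\<dots> = emeasure \<nu> A * emeasure \<mu> B"
    by (simp add: nn_integral_cmult sets)
  finally show ?thesis .
qed

section \<open>Orthogonal maps preserve Lebesgue measure\<close>

text \<open>The linear map that sends the i-th unit vector to \<open>c i\<close>.\<close>

definition lincomb :: "nat \<Rightarrow> (nat \<Rightarrow> nat \<Rightarrow> real) \<Rightarrow> (nat \<Rightarrow> real) \<Rightarrow> nat \<Rightarrow> real" where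
  "lincomb q c x = (\<lambda>j. \<Sum>i<q. x i * c i j)"

text \<open>The transpose of \<open>lincomb q c\<close>, hence its inverse on \<real>^q when
  \<open>c\<close> is orthonormal.\<close>

definition coords :: "nat \<Rightarrow> (nat \<Rightarrow> nat \<Rightarrow> real) \<Rightarrow> (nat \<Rightarrow> real) \<Rightarrow> nat \<Rightarrow> real" where
  "coords q c v = (\<lambda>i. if i < q then dot q v (c i) else 0)"

text \<open>Only orthonormality of \<open>q\<close> vectors is required; that they span follows in
  \<open>orthonormal_basis_complete\<close> and \<open>lincomb_coords\<close>.\<close>

definition orthonormal_basis :: "nat \<Rightarrow> (nat \<Rightarrow> nat \<Rightarrow> real) \<Rightarrow> bool" where
  "orthonormal_basis q c \<longleftrightarrow> (\<forall>i<q. \<forall>j\<ge>q. c i j = 0) \<and>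
     (\<forall>i<q. \<forall>k<q. dot q (c i) (c k) = (if i = k then 1 else 0))"

lemma dot_sum_left: "dot q (\<lambda>j. \<Sum>i\<in>F. x i * c i j) v = (\<Sum>i\<in>F. x i * dot q (c i) v)"
proof -
  have "dot q (\<lambda>j. \<Sum>i\<in>F. x i * c i j) v = (\<Sum>j<q. \<Sum>i\<in>F. x i * c i j * v j)"
    by (simp add: dot_def sum_distrib_right)
  also have "\<dots> = (\<Sum>i\<in>F. \<Sum>j<q. x i * c i j * v j)" by (rule sum.swap)
  finally show ?thesis by (simp add: dot_def sum_distrib_left mult.assoc)
qed

lemma dot_lincomb_basis:
  assumes c: "orthonormal_basis q c" and k: "k < q"
  shows "dot q (lincomb q c x) (c k) = x k"
proof -
  have "dot q (lincomb q c x) (c k) = (\<Sum>i<q. x i * (if i = k then 1 else 0))"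
    unfolding lincomb_def dot_sum_left using c k by (intro sum.cong) (auto simp: orthonormal_basis_def)
  then show ?thesis using k by (simp add: if_distrib[where f="(*) _"] cong: if_cong)
qed

lemma dot_lincomb:
  assumes c: "orthonormal_basis q c"
  shows "dot q (lincomb q c x) (lincomb q c y) = dot q x y"
proof -
  have "dot q (lincomb q c x) (lincomb q c y) = (\<Sum>i<q. x i * dot q (c i) (lincomb q c y))"
    unfolding lincomb_def[of q c x] dot_sum_left ..
  also have "\<dots> = dot q x y"
    unfolding dot_def[of q x y] by (intro sum.cong) (auto simp: dot_commute[of q _ "lincomb q c y"] dot_lincomb_basis[OF c])
  finally show ?thesis .
qed

lemma coords_lincomb:
  assumes "orthonormal_basis q c" "\<forall>i\<ge>q. x i = 0"
  shows "coords q c (lincomb q c x) = x"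
  using assms by (auto simp: coords_def dot_lincomb_basis)

text \<open>Completeness: the matrix \<open>N = C\<^sup>T C\<close> is a symmetric idempotent of trace \<open>q\<close>, so the squared
  Frobenius norm of \<open>I - N\<close>, which is its trace, vanishes.\<close>

lemma orthonormal_basis_complete:
  assumes c: "orthonormal_basis q c" and j: "j < q" "l < q"
  shows "(\<Sum>i<q. c i j * c i l) = (if j = l then 1 else 0)"
proof -
  define N where "N j l = (\<Sum>i<q. c i j * c i l)" for j l
  have trace: "(\<Sum>j<q. N j j) = real q"
  proof -
    have "(\<Sum>j<q. N j j) = (\<Sum>i<q. dot q (c i) (c i))"
      unfolding N_def dot_def by (rule sum.swap)
    also have "\<dots> = real q" using c by (simp add: orthonormal_basis_def)
    finally show ?thesis .
  qed
  have sq: "(\<Sum>l<q. N j l * N j l) = N j j" if "j < q" for j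
  proof -
    have "(\<Sum>l<q. N j l * N j l) = dot q (lincomb q c (\<lambda>i. c i j)) (lincomb q c (\<lambda>i. c i j))"
      by (simp add: dot_def lincomb_def N_def)
    also have "\<dots> = N j j" unfolding dot_lincomb[OF c] by (simp add: dot_def N_def)
    finally show ?thesis .
  qed
  define d :: "nat \<Rightarrow> nat \<Rightarrow> real" where "d j l = (if j = l then 1 else 0)" for j l
  have "(\<Sum>j<q. \<Sum>l<q. (d j l - N j l)\<^sup>2) = (\<Sum>j<q. \<Sum>l<q. N j l * N j l + (if j = l then 1 - 2 * N j j else 0))"
    by (intro sum.cong refl) (auto simp: d_def power2_eq_square algebra_simps)
  also have "\<dots> = (\<Sum>j<q. N j j + (1 - 2 * N j j))"
    by (intro sum.cong refl) (simp add: sum.distrib sq)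
  also have "\<dots> = 0" using trace by (simp add: sum.distrib sum_subtractf flip: sum_distrib_left)
  finally have "(\<Sum>j<q. \<Sum>l<q. (d j l - N j l)\<^sup>2) = 0" .
  then have "\<forall>j<q. \<forall>l<q. (d j l - N j l)\<^sup>2 = 0"
    by (simp add: sum_nonneg_eq_0_iff sum_nonneg)
  then show ?thesis using j unfolding N_def[symmetric] d_def[symmetric] by auto
qed

lemma lincomb_coords:
  assumes c: "orthonormal_basis q c" and v: "\<forall>i\<ge>q. v i = 0"
  shows "lincomb q c (coords q c v) = v"
proof
  fix l show "lincomb q c (coords q c v) l = v l"
  proof (cases "l < q")
    case True
    have "lincomb q c (coords q c v) l = (\<Sum>i<q. \<Sum>j<q. v j * c i j * c i l)"
      by (simp add: lincomb_def coords_def dot_def sum_distrib_right)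
    also have "\<dots> = (\<Sum>j<q. v j * (\<Sum>i<q. c i j * c i l))"
      by (subst sum.swap) (simp add: sum_distrib_left mult.assoc)
    also have "\<dots> = (\<Sum>j<q. if j = l then v j else 0)"
      using True by (intro sum.cong refl) (simp add: orthonormal_basis_complete[OF c])
    also have "\<dots> = v l" using True by simp
    finally show ?thesis .
  next
    case False
    then show ?thesis using c v by (simp add: lincomb_def orthonormal_basis_def)
  qed
qed

lemma measurable_lincomb[measurable]: "lincomb q c \<in> measurable borel borel"
  unfolding lincomb_def by (rule measurable_into_fun) measurable

lemma measurable_coords[measurable]: "coords q c \<in> measurable borel borel"
  unfolding coords_def by (rule measurable_into_fun) measurable

lemma emeasure_lborel_fun_ball_finite:
  "emeasure (lborel_fun q) {v. dot q v v \<le> real n} < \<infinity>"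
proof -
  have "emeasure (lborel_fun q) {v. dot q v v \<le> real n} \<le> emeasure (lborel_fun q) {v. \<forall>i<q. v i \<in> {- real n..real n}}"
  proof (rule emeasure_mono)
    have "{v \<in> space borel. \<forall>i\<in>{..<q}. v i \<in> {- real n..real n}} \<in> sets (borel :: (nat \<Rightarrow> real) measure)"
      by measurable
    then show "{v. \<forall>i<q. v i \<in> {- real n..real n}} \<in> sets (lborel_fun q)"
      by (simp add: Ball_def sets_lborel_fun)
    show "{v. dot q v v \<le> real n} \<subseteq> {v. \<forall>i<q. v i \<in> {- real n..real n}}"
    proof safe
      fix v i assume v: "dot q v v \<le> real n" and i: "i < q"
      have "v i * v i \<le> dot q v v"
        unfolding dot_def using i by (intro member_le_sum[of i "{..<q}" "\<lambda>i. v i * v i"]) auto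
      \<comment> \<open>The box with half-side \<open>n\<close> contains the ball because
        \<open>n\<close> is at most its square.\<close>
      then have "(v i)\<^sup>2 \<le> (real n)\<^sup>2"
        using v of_nat_mono[OF le_square[of n], where 'a=real] by (simp add: power2_eq_square)
      then have "\<bar>v i\<bar> \<le> real n" by (simp add: abs_le_square_iff[symmetric])
      then show "v i \<in> {- real n..real n}" by auto
    qed
  qed
  also have "\<dots> < \<infinity>"
    by (subst emeasure_lborel_fun_box) (auto simp: ennreal_power)
  finally show ?thesis .
qed

text \<open>The unit ball of \<real>^q without the multiples of \<open>evec q\<close>: these project
  to 0 in the hyperplane and have no radial projection to the sphere.\<close>

definition punctured_ball :: "nat \<Rightarrow> (nat \<Rightarrow> real) set" where
  "punctured_ball q = {v. (\<forall>i\<ge>q. v i = 0) \<and> dot q v v \<le> 1 \<and> center q v \<noteq> (\<lambda>i. 0)}"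

lemma measurable_center[measurable]: "center q \<in> measurable borel borel"
  unfolding center_def by (rule measurable_into_fun) measurable

lemma measurable_ball_set[measurable]: "{v. dot q v v \<le> c} \<in> sets borel"
proof -
  have "{v \<in> space borel. dot q v v \<le> c} \<in> sets borel" by measurable
  then show ?thesis by simp
qed

lemma measurable_punctured_ball[measurable]: "punctured_ball q \<in> sets borel"
proof -
  have "{v \<in> space borel. \<forall>i. center q v i = 0} \<in> sets borel"
    using measurable_compose[OF measurable_center measurable_coord] by measurable
  then have "{v. center q v = (\<lambda>i. 0)} \<in> sets borel" by (simp add: fun_eq_iff)
  moreover have "punctured_ball q = ({v. \<forall>i\<ge>q. v i = 0} \<inter> {v. dot q v v \<le> 1}) - {v. center q v = (\<lambda>i. 0)}"
    by (auto simp: punctured_ball_def)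
  ultimately show ?thesis by simp
qed

lemma emeasure_punctured_ball_pos:
  assumes q: "2 \<le> q"
  shows "emeasure (lborel_fun q) (punctured_ball q) > 0"
proof -
  \<comment> \<open>A box inside the set: coordinates of size at most 1/q give squared norm at most
    1, and coordinate 0 is at least 1/(2q) while coordinate 1 is at most 1/(4q), so the vector is
    not constant.\<close>
  define A where "A i = (if i = 0 then {1 / (2 * real q)..1 / real q} else {0..1 / (4 * real q)})" for i :: nat
  define B where "B = {v. \<forall>i<q. v i \<in> A i}"
  have "0 < (\<Prod>i<q. emeasure lborel (A i))"
  proof -
    have "(\<Prod>i<q. emeasure lborel (A i)) \<noteq> 0"
      using q by (auto simp: A_def field_simps)
    then show ?thesis by (simp add: zero_less_iff_neq_zero)
  qed
  also have "\<dots> = emeasure (lborel_fun q) B"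
    unfolding B_def by (rule emeasure_lborel_fun_box[symmetric]) (auto simp: A_def)
  also have "\<dots> \<le> emeasure (lborel_fun q) (punctured_ball q)"
  proof (rule emeasure_mono_AE)
    have "v \<in> punctured_ball q" if v: "v \<in> B" "\<forall>i\<ge>q. v i = 0" for v
    proof -
      have b: "\<bar>v i\<bar> \<le> 1 / real q" if "i < q" for i
      proof -
        have "1 / (4 * real q) \<le> 1 / real q" using q by (simp add: field_simps)
        moreover have "v i \<in> A i" using v(1) that by (simp add: B_def)
        ultimately show ?thesis using q by (auto simp: A_def split: if_splits)
      qed
      have "dot q v v \<le> (\<Sum>i<q. (1 / real q) * (1 / real q))"
        unfolding dot_def
      proof (rule sum_mono)
        fix i assume "i \<in> {..<q}"
        then have i: "i < q" by simp
        show "v i * v i \<le> 1 / real q * (1 / real q)"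
          using mult_mono[OF b[OF i] b[OF i]] unfolding abs_mult_self_eq by simp
      qed
      also have "\<dots> \<le> 1" using q by simp
      finally have d: "dot q v v \<le> 1" .
      have "v 0 \<in> A 0" "v 1 \<in> A 1" using v(1) q by (auto simp: B_def)
      then have "v 1 \<le> 1 / (4 * real q)" "1 / (2 * real q) \<le> v 0" by (simp_all add: A_def)
      moreover have "1 / (4 * real q) < 1 / (2 * real q)" using q by (intro divide_strict_left_mono) auto
      ultimately have "v 1 < v 0" by linarith
      moreover have "center q v 0 - center q v 1 = v 0 - v 1" using q by (simp add: center_def evec_def)
      ultimately have "center q v \<noteq> (\<lambda>i. 0)" by auto
      with d v show ?thesis by (auto simp: punctured_ball_def)
    qed
    then show "AE v in lborel_fun q. v \<in> B \<longrightarrow> v \<in> punctured_ball q"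
      using AE_lborel_fun[of q] by auto
  qed (simp add: sets_lborel_fun)
  finally show ?thesis .
qed

text \<open>The pushforward is again translation invariant, and
  \<open>translation_invariant_swap\<close> with the unit ball as symmetric set makes it
  proportional to Lebesgue measure. Orthogonal maps preserve that ball, whose measure is positive
  and finite, so the factor is 1.\<close>

lemma distr_lincomb:
  assumes c: "orthonormal_basis q c" and q: "2 \<le> q"
  shows "distr (lborel_fun q) borel (lincomb q c) = lborel_fun q"
proof (rule measure_eqI)
  define \<mu> where "\<mu> = distr (lborel_fun q) borel (lincomb q c)"
  let ?L = "lborel_fun q"
  let ?Q = "\<lambda>n::nat. {v. dot q v v \<le> real n}"
  have Lm: "lincomb q c \<in> measurable ?L borel"
    by measurable
  have Q: "emeasure \<mu> (?Q n) = emeasure ?L (?Q n)" for n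
    unfolding \<mu>_def by (subst emeasure_distr[OF Lm]) (auto simp: vimage_def dot_lincomb[OF c])
  have cover: "(\<Union>n. ?Q n) = UNIV" using real_arch_simple by auto
  have sf: "sigma_finite_measure M" if "sets M = sets borel" "\<And>n. emeasure M (?Q n) < \<infinity>" for M
  proof
    show "\<exists>A. countable A \<and> A \<subseteq> sets M \<and> \<Union>A = space M \<and> (\<forall>a\<in>A. emeasure M a \<noteq> \<infinity>)"
      using that cover sets_eq_imp_space_eq[OF that(1)] by (intro exI[of _ "range ?Q"]) (auto simp: less_top)
  qed
  have swap: "emeasure \<mu> A * emeasure ?L (?Q 1) = emeasure ?L A * emeasure \<mu> (?Q 1)" if A: "A \<in> sets borel" for A
  proof (rule translation_invariant_swap[where q=q])
    show "sigma_finite_measure ?L"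
      by (intro sf sets_lborel_fun emeasure_lborel_fun_ball_finite)
    have "sets \<mu> = sets borel" by (simp add: \<mu>_def)
    then show "sigma_finite_measure \<mu>"
      by (rule sf) (simp only: Q emeasure_lborel_fun_ball_finite)
    have "AE x in ?L. lincomb q c x \<in> {v. \<forall>i\<ge>q. v i = 0}"
      using c by (auto simp: lincomb_def orthonormal_basis_def)
    then show "AE x in \<mu>. \<forall>i\<ge>q. x i = 0"
      unfolding \<mu>_def by (subst AE_distr_iff[OF Lm]) auto
    show "distr \<mu> borel (\<lambda>v i. v i + a i) = \<mu>" if a: "\<And>i. i \<ge> q \<Longrightarrow> a i = 0" for a
    proof -
      \<comment> \<open>Translating by \<open>a\<close> after the linear map is translating by the
        preimage \<open>b\<close> of \<open>a\<close> before it.\<close>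
      define b where "b = coords q c a"
      have Mb: "lincomb q c b = a" unfolding b_def using a by (intro lincomb_coords[OF c]) auto
      have m: "(\<lambda>v i. v i + a i) \<in> measurable borel borel" "(\<lambda>v i. v i + b i) \<in> measurable ?L borel" by measurable
      have "distr \<mu> borel (\<lambda>v i. v i + a i) = distr ?L borel ((\<lambda>v i. v i + a i) \<circ> lincomb q c)"
        unfolding \<mu>_def by (rule distr_distr[OF m(1) Lm])
      also have "(\<lambda>v i. v i + a i) \<circ> lincomb q c = lincomb q c \<circ> (\<lambda>v i. v i + b i)"
      proof
        fix v show "((\<lambda>v i. v i + a i) \<circ> lincomb q c) v = (lincomb q c \<circ> (\<lambda>v i. v i + b i)) v"
          unfolding Mb[symmetric] by (auto simp: lincomb_def distrib_right sum.distrib)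
      qed
      also have "distr ?L borel \<dots> = distr (distr ?L borel (\<lambda>v i. v i + b i)) borel (lincomb q c)"
        by (rule distr_distr[OF measurable_lincomb m(2), symmetric])
      also have "distr ?L borel (\<lambda>v i. v i + b i) = ?L"
        by (rule lborel_fun_translate) (simp add: b_def coords_def)
      finally show ?thesis by (simp add: \<mu>_def)
    qed
    show "distr ?L borel (\<lambda>v i. v i + a i) = ?L" if a: "\<And>i. i \<ge> q \<Longrightarrow> a i = 0" for a
      by (rule lborel_fun_translate[OF a])
    show "(\<lambda>i. - v i) \<in> ?Q 1 \<longleftrightarrow> v \<in> ?Q 1" for v by (simp add: dot_def)
  qed (use A AE_lborel_fun in \<open>auto simp: \<mu>_def sets_lborel_fun\<close>)
  have eq: "emeasure ?L (?Q 1) * emeasure \<mu> A = emeasure ?L (?Q 1) * emeasure ?L A" if "A \<in> sets borel" for A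
    using swap[OF that] unfolding Q by (simp add: mult.commute)
  have "emeasure ?L (punctured_ball q) \<le> emeasure ?L (?Q 1)"
    by (intro emeasure_mono) (auto simp: punctured_ball_def sets_lborel_fun)
  then have "emeasure ?L (?Q 1) \<noteq> 0" using emeasure_punctured_ball_pos[OF q] by auto
  moreover have "emeasure ?L (?Q 1) \<noteq> \<top>" using emeasure_lborel_fun_ball_finite[of q 1] by simp
  ultimately have "emeasure \<mu> A = emeasure ?L A" if "A \<in> sets borel" for A
    using eq[OF that] unfolding ennreal_mult_cancel_left by blast
  then show "emeasure (distr ?L borel (lincomb q c)) A = emeasure ?L A"
    if "A \<in> sets (distr ?L borel (lincomb q c))" for A
    using that unfolding \<mu>_def by simp
qed (simp add: sets_lborel_fun)

section \<open>Existence of the invariant measure\<close>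

lemma dot_evec: "dot q v (evec q) = (\<Sum>i<q. v i)"
  by (simp add: dot_def evec_def)

lemma center_in_Mtilde:
  assumes "\<forall>i\<ge>q. v i = 0" "0 < q" shows "center q v \<in> Mtilde q"
  using assms by (simp add: Mtilde_iff center_def evec_def sum_subtractf)

lemma center_Mtilde: "v \<in> Mtilde q \<Longrightarrow> center q v = v"
  by (simp add: Mtilde_iff center_def)

lemma isometry_lin:
  assumes "hyperplane_isometry q T" "u \<in> Mtilde q" "v \<in> Mtilde q"
  shows "T (\<lambda>i. a * u i + b * v i) = (\<lambda>i. a * T u i + b * T v i)"
  using assms unfolding hyperplane_isometry_def by blast

lemma isometry_zero:
  assumes T: "hyperplane_isometry q T" shows "T (\<lambda>i. 0) = (\<lambda>i. 0)"
proof -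
  have "(\<lambda>i. 0) \<in> Mtilde q" by (simp add: Mtilde_iff)
  from isometry_lin[OF T this this, of 0 0] show ?thesis by simp
qed

lemma Mtilde_sum:
  assumes "\<And>i. i \<in> F \<Longrightarrow> p i \<in> Mtilde q"
  shows "(\<lambda>j. \<Sum>i\<in>F. x i * p i j) \<in> Mtilde q"
proof -
  have "(\<Sum>j<q. \<Sum>i\<in>F. x i * p i j) = (\<Sum>i\<in>F. x i * (\<Sum>j<q. p i j))"
    by (subst sum.swap) (simp add: sum_distrib_left)
  then show ?thesis using assms by (simp add: Mtilde_iff)
qed

lemma isometry_sum:
  assumes T: "hyperplane_isometry q T" and "finite F" "\<And>i. i \<in> F \<Longrightarrow> p i \<in> Mtilde q"
  shows "T (\<lambda>j. \<Sum>i\<in>F. x i * p i j) = (\<lambda>j. \<Sum>i\<in>F. x i * T (p i) j)"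
  using assms(2,3)
proof (induction F rule: finite_induct)
  case empty
  then show ?case by (simp add: isometry_zero[OF T])
next
  case (insert k F)
  have "p k \<in> Mtilde q" "(\<lambda>j. \<Sum>i\<in>F. x i * p i j) \<in> Mtilde q"
    using insert.prems by (auto intro: Mtilde_sum)
  from isometry_lin[OF T this, of "x k" 1] show ?case using insert by simp
qed

text \<open>The isometry extends to all of \<open>\<real>\<^sup>q\<close> by fixing the vector \<open>e\<close>.\<close>

lemma isometry_extension:
  assumes T: "hyperplane_isometry q T" and q: "0 < q"
  obtains c where "orthonormal_basis q c"
    "\<And>x. \<forall>i\<ge>q. x i = 0 \<Longrightarrow> lincomb q c x = (\<lambda>j. T (center q x) j + (\<Sum>i<q. x i) / real q * evec q j)"
proof -
  define \<delta> :: "nat \<Rightarrow> nat \<Rightarrow> real" where "\<delta> i = (\<lambda>k. if k = i then 1 else 0)" for i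
  define p where "p i = center q (\<delta> i)" for i
  \<comment> \<open>The i-th unit vector is \<open>p i\<close> plus 1/q times \<open>evec q\<close>;
    the extension applies \<open>T\<close> to the first part and fixes the second.\<close>
  define c where "c i = (\<lambda>j. T (p i) j + 1 / real q * evec q j)" for i
  have p: "p i \<in> Mtilde q" if "i < q" for i
    using that q unfolding p_def by (intro center_in_Mtilde) (auto simp: \<delta>_def)
  have Tp: "T (p i) \<in> Mtilde q" if "i < q" for i
    using T p[OF that] by (simp add: hyperplane_isometry_def)
  have dotp: "dot q (p i) (p k) = (if i = k then 1 else 0) - 1 / real q" if "i < q" "k < q" for i k
  proof -
    have "p i = (\<lambda>j. \<delta> i j - 1 / real q * evec q j)" if "i < q" for i
      using that by (simp add: p_def center_def \<delta>_def)
    moreover have "dot q v (\<delta> i) = v i" if "i < q" for v i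
      using that by (simp add: dot_def \<delta>_def if_distrib[where f="(*) _"] cong: if_cong)
    ultimately show ?thesis using that q
      by (simp only: dot_simps dot_evec dot_commute[of q "evec q" "\<delta> k"])
        (simp add: \<delta>_def evec_def)
  qed
  have e: "dot q v (evec q) = 0" "dot q (evec q) v = 0" if "v \<in> Mtilde q" for v
    using that by (simp_all add: Mtilde_iff dot_evec dot_commute[of q "evec q"])
  have ee: "dot q (evec q) (evec q) = real q" by (simp add: dot_evec) (simp add: evec_def)
  have "orthonormal_basis q c"
    unfolding orthonormal_basis_def
  proof safe
    fix i j assume "i < q" "j \<ge> q"
    then show "c i j = 0" using Tp[of i] by (simp add: c_def Mtilde_iff evec_def)
  next
    fix i k assume ik: "i < q" "k < q"
    have "dot q (c i) (c k) = dot q (T (p i)) (T (p k)) + 1 / real q"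
      unfolding c_def using q by (simp only: dot_simps e[OF Tp[OF ik(1)]] e[OF Tp[OF ik(2)]] ee) simp
    also have "\<dots> = (if i = k then 1 else 0)"
      using isometry_dot[OF T p[OF ik(1)] p[OF ik(2)]] dotp[OF ik] by simp
    finally show "dot q (c i) (c k) = (if i = k then 1 else 0)" .
  qed
  moreover have "lincomb q c x = (\<lambda>j. T (center q x) j + (\<Sum>i<q. x i) / real q * evec q j)"
    if x: "\<forall>i\<ge>q. x i = 0" for x
  proof -
    have "center q x = (\<lambda>j. \<Sum>i<q. x i * p i j)"
    proof
      fix j show "center q x j = (\<Sum>i<q. x i * p i j)"
      proof (cases "j < q")
        case True
        have "(\<Sum>i<q. x i * p i j) = (\<Sum>i<q. (if i = j then x i else 0) - x i / real q)"
          using True by (intro sum.cong refl) (auto simp: p_def center_def \<delta>_def evec_def algebra_simps)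
        also have "\<dots> = center q x j"
          using True by (simp add: sum_subtractf center_def evec_def sum_divide_distrib)
        finally show ?thesis ..
      next
        case False
        then show ?thesis using x by (simp add: center_def evec_def p_def \<delta>_def)
      qed
    qed
    then have "T (center q x) = (\<lambda>j. \<Sum>i<q. x i * T (p i) j)"
      using isometry_sum[OF T, of "{..<q}" p x] p by simp
    then show ?thesis
      by (simp add: lincomb_def c_def distrib_left sum.distrib sum_divide_distrib sum_distrib_right)
  qed
  ultimately show ?thesis by (rule that)
qed

section \<open>Projecting the ball to the sphere\<close>

definition sphere_proj :: "nat \<Rightarrow> real \<Rightarrow> (nat \<Rightarrow> real) \<Rightarrow> (nat \<Rightarrow> real)" where
  "sphere_proj q \<rho> x = (\<lambda>i. \<rho> / vnorm q (center q x) * center q x i)"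

lemma vnorm_scale: "vnorm q (\<lambda>i. a * v i) = \<bar>a\<bar> * vnorm q v"
  unfolding vnorm_def L2_set_def
  by (simp add: power_mult_distrib real_sqrt_mult flip: sum_distrib_left)

lemma vnorm_eq_0: "\<forall>i\<ge>q. v i = 0 \<Longrightarrow> vnorm q v = 0 \<longleftrightarrow> v = (\<lambda>i. 0)"
proof -
  assume v: "\<forall>i\<ge>q. v i = 0"
  have "vnorm q v = 0 \<longleftrightarrow> dot q v v = 0" by (simp add: dot_self)
  then show ?thesis using v by (auto simp: dot_self_eq_0 fun_eq_iff) (metis not_le)
qed

lemma sphere_proj_in:
  assumes x: "x \<in> punctured_ball q" and q: "0 < q" and \<rho>: "0 < \<rho>"
  shows "sphere_proj q \<rho> x \<in> Stilde q \<rho>"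
proof -
  have M: "center q x \<in> Mtilde q" using x q by (intro center_in_Mtilde) (auto simp: punctured_ball_def)
  then have "vnorm q (center q x) \<noteq> 0"
    using x vnorm_eq_0[of q "center q x"] by (auto simp: punctured_ball_def Mtilde_iff)
  then have "vnorm q (sphere_proj q \<rho> x) = \<rho>"
    unfolding sphere_proj_def vnorm_scale using \<rho> vnorm_nonneg[of q "center q x"] by simp
  moreover have "sphere_proj q \<rho> x \<in> Mtilde q"
    using Mtilde_lin[OF M M, of "\<rho> / vnorm q (center q x)" 0] by (simp add: sphere_proj_def)
  ultimately show ?thesis by (simp add: Stilde_def)
qed

lemma measurable_sphere_proj[measurable]: "sphere_proj q \<rho> \<in> measurable borel borel"
proof -
  have v: "vnorm q v = sqrt (dot q v v)" for v by (simp add: dot_self vnorm_nonneg)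
  have [measurable]: "(\<lambda>x. center q x i) \<in> borel_measurable borel" for i
    using measurable_compose[OF measurable_center measurable_coord] .
  show ?thesis
    unfolding sphere_proj_def v by (rule measurable_into_fun) measurable
qed

lemma invariant_prob_exists:
  assumes q: "2 \<le> q" and \<rho>: "0 < \<rho>"
  obtains U where "invariant_prob q \<rho> U"
proof -
  define D where "D = punctured_ball q"
  let ?L = "lborel_fun q"
  define S where "S = Stilde q \<rho>"
  define f where "f = sphere_proj q \<rho>"
  have D[measurable]: "D \<in> sets borel" by (simp add: D_def measurable_punctured_ball)
  have S[measurable]: "S \<in> sets borel" using \<rho> by (simp add: S_def)
  have fm[measurable]: "f \<in> measurable borel borel" by (simp add: f_def measurable_sphere_proj)
  have fS: "f x \<in> S" if "x \<in> D" for x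
    using that q \<rho> by (auto simp: f_def S_def D_def intro: sphere_proj_in)
  have pos: "emeasure ?L D \<noteq> 0" using emeasure_punctured_ball_pos[OF q] by (auto simp: D_def)
  have "emeasure ?L D \<le> emeasure ?L {v. dot q v v \<le> real 1}"
    by (intro emeasure_mono) (auto simp: D_def punctured_ball_def sets_lborel_fun)
  then have fin: "emeasure ?L D \<noteq> \<infinity>" using emeasure_lborel_fun_ball_finite[of q 1] by auto
  define N where "N = uniform_measure ?L D"
  have N: "prob_space N" unfolding N_def by (rule prob_space_uniform_measure[OF pos fin])
  have setsN: "sets N = sets borel" by (simp add: N_def sets_lborel_fun)
  obtain s where s: "s \<in> S"
  proof -
    have "D \<noteq> {}" using pos by auto
    then show ?thesis using fS that by blast
  qed
  \<comment> \<open>The default \<open>s\<close> is taken outside \<open>D\<close>, a null set of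
    \<open>N\<close>; it lies on the sphere so that \<open>g\<close> maps every point into
    \<open>S\<close>.\<close>
  define g where "g x = (if x \<in> D then f x else s)" for x
  have gS: "g x \<in> S" for x using fS s by (simp add: g_def)
  have "g \<in> measurable borel borel" unfolding g_def by measurable
  then have gm: "g \<in> measurable N (restrict_space borel S)"
    using gS by (intro measurable_restrict_space2) (auto simp: measurable_cong_sets[OF setsN refl])
  define U where "U = distr N (restrict_space borel S) g"
  have setsU: "A \<in> sets U \<longleftrightarrow> A \<subseteq> S \<and> A \<in> sets borel" for A
    by (simp add: U_def sets_restrict_space_iff)
  have eU: "emeasure U A = emeasure ?L {x \<in> D. f x \<in> A} / emeasure ?L D" if "A \<in> sets U" for A
  proof -
    have A: "A \<in> sets borel" using that setsU by auto
    have mA: "g -` A \<in> sets borel"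
      using measurable_sets[OF \<open>g \<in> measurable borel borel\<close> A] by simp
    have "emeasure U A = emeasure N (g -` A \<inter> space N)"
      unfolding U_def using that gm by (intro emeasure_distr) (auto simp: U_def)
    also have "g -` A \<inter> space N = g -` A" by (simp add: N_def)
    also have "emeasure N (g -` A) = emeasure ?L (D \<inter> g -` A) / emeasure ?L D"
      unfolding N_def using mA by (intro emeasure_uniform_measure) (auto simp: sets_lborel_fun)
    also have "D \<inter> g -` A = {x \<in> D. f x \<in> A}" by (auto simp: g_def)
    finally show ?thesis .
  qed
  have "emeasure U (T ` A) = emeasure U A" if T: "hyperplane_isometry q T" and A: "A \<in> sets U" for T A
  proof -
    have Ab[measurable]: "A \<in> sets borel" and AS: "A \<subseteq> S" using A setsU by auto
    obtain c where c: "orthonormal_basis q c"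
      and Tc: "\<And>x. \<forall>i\<ge>q. x i = 0 \<Longrightarrow> lincomb q c x = (\<lambda>j. T (center q x) j + (\<Sum>i<q. x i) / real q * evec q j)"
      using isometry_extension[OF T] q by auto
    have SM: "v \<in> Mtilde q" if "v \<in> S" for v using that by (simp add: S_def Stilde_def)
    have TM: "T v = lincomb q c v" if "v \<in> Mtilde q" for v
      using Tc[of v] that center_Mtilde[OF that] by (simp add: Mtilde_iff)
    have sum_c: "(\<Sum>j<q. lincomb q c x j) = (\<Sum>j<q. x j)" if x: "\<forall>i\<ge>q. x i = 0" for x
    proof -
      have "T (center q x) \<in> Mtilde q"
        using T center_in_Mtilde[OF x] q by (simp add: hyperplane_isometry_def)
      then show ?thesis using q by (simp add: Tc[OF x] sum.distrib Mtilde_iff) (simp add: evec_def)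
    qed
    have center_c: "center q (lincomb q c x) = T (center q x)" if x: "\<forall>i\<ge>q. x i = 0" for x
      unfolding center_def[of q "lincomb q c x"] sum_c[OF x] by (simp add: Tc[OF x])
    have out: "\<forall>i\<ge>q. lincomb q c x i = 0" for x
      using c by (simp add: lincomb_def orthonormal_basis_def)
    \<comment> \<open>Writing the image as a preimage under \<open>coords q c\<close> makes it
      measurable.\<close>
    have imT: "T ` A = {v \<in> S. coords q c v \<in> A}"
    proof (intro equalityI subsetI)
      fix w assume "w \<in> T ` A"
      then obtain v where v: "v \<in> A" "w = T v" by auto
      then have vM: "v \<in> Mtilde q" and vS: "v \<in> S" using AS SM by auto
      have "w \<in> S" using vS T v(2) by (simp add: S_def Stilde_def hyperplane_isometry_def)
      moreover have "coords q c w = v"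
        unfolding v(2) TM[OF vM] using vM by (intro coords_lincomb[OF c]) (simp add: Mtilde_iff)
      ultimately show "w \<in> {v \<in> S. coords q c v \<in> A}" using v by simp
    next
      fix w assume "w \<in> {v \<in> S. coords q c v \<in> A}"
      then have w: "w \<in> S" "coords q c w \<in> A" by auto
      have "T (coords q c w) = lincomb q c (coords q c w)" using w AS SM by (intro TM) auto
      also have "\<dots> = w" using SM[OF w(1)] by (intro lincomb_coords[OF c]) (simp add: Mtilde_iff)
      finally show "w \<in> T ` A" using w by force
    qed
    have TA: "T ` A \<in> sets U"
    proof -
      have "{v \<in> space borel. v \<in> S \<and> coords q c v \<in> A} \<in> sets borel" by measurable
      then show ?thesis unfolding setsU imT by auto
    qed
    \<comment> \<open>The extension of \<open>T\<close> commutes with centring and preserves norms,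
      so it maps \<open>D\<close> into itself and intertwines the projection with
      \<open>T\<close>.\<close>
    have fc: "f (lincomb q c x) = T (f x)" and cD: "lincomb q c x \<in> D" if x: "x \<in> D" for x
    proof -
      have xE: "\<forall>i\<ge>q. x i = 0" using x by (simp add: D_def punctured_ball_def)
      have xM: "center q x \<in> Mtilde q" using center_in_Mtilde[OF xE] q by simp
      have vT: "vnorm q (T (center q x)) = vnorm q (center q x)"
        using T xM by (simp add: hyperplane_isometry_def)
      show "f (lincomb q c x) = T (f x)"
        using isometry_lin[OF T xM xM, of "\<rho> / vnorm q (center q x)" 0]
        by (simp add: f_def sphere_proj_def center_c[OF xE] vT)
      have "vnorm q (center q x) \<noteq> 0"
        using x xM vnorm_eq_0[of q "center q x"] by (auto simp: D_def punctured_ball_def Mtilde_iff)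
      then have "T (center q x) \<noteq> (\<lambda>i. 0)" using vT vnorm_eq_0[of q "\<lambda>i. 0"] by auto
      then show "lincomb q c x \<in> D"
        using x out by (simp add: D_def punctured_ball_def dot_lincomb[OF c] center_c[OF xE])
    qed
    have inD: "x \<in> D" if "lincomb q c x \<in> D" "\<forall>i\<ge>q. x i = 0" for x
    proof -
      have "T (center q x) \<noteq> (\<lambda>i. 0)"
        using that by (simp add: D_def punctured_ball_def center_c)
      then have "center q x \<noteq> (\<lambda>i. 0)" using isometry_zero[OF T] by auto
      then show ?thesis using that by (simp add: D_def punctured_ball_def dot_lincomb[OF c])
    qed
    have inj: "T v \<in> T ` A \<longleftrightarrow> v \<in> A" if "v \<in> S" for v
    proof -
      have "coords q c (T v) = v" if "v \<in> S" for v
        unfolding TM[OF SM[OF that]] using SM[OF that] by (intro coords_lincomb[OF c]) (simp add: Mtilde_iff)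
      then have "inj_on T S" by (rule inj_on_inverseI[where g = "coords q c"])
      then show ?thesis using inj_on_image_mem_iff that AS by metis
    qed
    have TAb[measurable]: "T ` A \<in> sets borel" using TA setsU by auto
    have E: "{x \<in> D. f x \<in> T ` A} \<in> sets borel" "{x \<in> D. f x \<in> A} \<in> sets borel"
    proof -
      have "{x \<in> space borel. x \<in> D \<and> f x \<in> T ` A} \<in> sets borel" "{x \<in> space borel. x \<in> D \<and> f x \<in> A} \<in> sets borel"
        by measurable
      then show "{x \<in> D. f x \<in> T ` A} \<in> sets borel" "{x \<in> D. f x \<in> A} \<in> sets borel" by auto
    qed
    have lm: "lincomb q c \<in> measurable ?L borel" by measurable
    have "emeasure ?L {x \<in> D. f x \<in> T ` A} = emeasure (distr ?L borel (lincomb q c)) {x \<in> D. f x \<in> T ` A}"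
      by (simp add: distr_lincomb[OF c q])
    also have "\<dots> = emeasure ?L (lincomb q c -` {x \<in> D. f x \<in> T ` A})"
      using emeasure_distr[OF lm E(1)] by simp
    also have "\<dots> = emeasure ?L {x \<in> D. f x \<in> A}"
    proof (rule emeasure_eq_AE)
      \<comment> \<open>The sets can differ at points with nonzero coordinates from \<open>q\<close>
        on, since \<open>lincomb\<close> ignores these; such points form a null set.\<close>
      show "AE x in ?L. x \<in> lincomb q c -` {x \<in> D. f x \<in> T ` A} \<longleftrightarrow> x \<in> {x \<in> D. f x \<in> A}"
        using AE_lborel_fun[of q]
      proof eventually_elim
        case (elim x)
        show ?case
        proof (cases "x \<in> D")
          case True
          then show ?thesis using fc[OF True] cD[OF True] inj[OF fS[OF True]] by simp
        next
          case False
          then show ?thesis using inD[of x] elim by auto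
        qed
      qed
      show "lincomb q c -` {x \<in> D. f x \<in> T ` A} \<in> sets ?L"
        using measurable_sets[OF lm E(1)] by simp
    qed (simp add: sets_lborel_fun E)
    finally show ?thesis using eU[OF TA] eU[OF A] by simp
  qed
  moreover have "prob_space U" unfolding U_def by (rule prob_space.prob_space_distr[OF N gm])
  ultimately have "invariant_prob q \<rho> U"
    by (simp add: invariant_prob_def U_def S_def)
  then show ?thesis by (rule that)
qed

text \<open>With existence and uniqueness the definite description denotes, so everything proved for
  invariant measures applies to it.\<close>

lemma invariant_prob_uniform_sphere:
  assumes q: "2 \<le> q" and \<rho>: "0 < \<rho>"
  shows "invariant_prob q \<rho> (uniform_sphere q \<rho>)"
proof -
  obtain U where U: "invariant_prob q \<rho> U" using invariant_prob_exists[OF assms] .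
  have "uniform_sphere q \<rho> = (THE U. invariant_prob q \<rho> U)"
    by (simp add: uniform_sphere_def invariant_prob_def)
  moreover have "invariant_prob q \<rho> (THE U. invariant_prob q \<rho> U)"
    using U invariant_prob_unique[OF _ U \<rho>] by (rule theI)
  ultimately show ?thesis by simp
qed

section \<open>The maximal configurations\<close>

text \<open>Abel summation: a sorted vector is a nonnegative combination of the step vectors, on each of
  which the inner product with \<open>z\<close> is a tail sum of \<open>z\<close>.\<close>

lemma dot_Abel:
  assumes z: "(\<Sum>i<q. z i) = 0"
  shows "dot q z w = (\<Sum>k\<in>{1..<q}. (w k - w (k - 1)) * (\<Sum>i\<in>{k..<q}. z i))"
proof -
  have "w i = w 0 + (\<Sum>k\<in>{1..i}. w k - w (k - 1))" for i
    by (induction i) auto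
  then have "dot q z w = (\<Sum>i<q. z i * w 0 + (\<Sum>k\<in>{1..i}. z i * (w k - w (k - 1))))"
    unfolding dot_def by (intro sum.cong refl) (metis distrib_left sum_distrib_left)
  also have "\<dots> = (\<Sum>i<q. \<Sum>k\<in>{1..i}. z i * (w k - w (k - 1)))"
    using z by (simp add: sum.distrib flip: sum_distrib_right)
  also have "\<dots> = (\<Sum>i<q. \<Sum>k\<in>{1..<q}. if k \<le> i then z i * (w k - w (k - 1)) else 0)"
  proof (rule sum.cong[OF refl])
    fix i assume "i \<in> {..<q}"
    then have "{1..i} = {k \<in> {1..<q}. k \<le> i}" by auto
    then show "(\<Sum>k\<in>{1..i}. z i * (w k - w (k - 1))) = (\<Sum>k\<in>{1..<q}. if k \<le> i then z i * (w k - w (k - 1)) else 0)"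
      by (simp only: sum.inter_filter finite_atLeastLessThan)
  qed
  also have "\<dots> = (\<Sum>k\<in>{1..<q}. \<Sum>i<q. if k \<le> i then z i * (w k - w (k - 1)) else 0)"
    by (rule sum.swap)
  also have "\<dots> = (\<Sum>k\<in>{1..<q}. (w k - w (k - 1)) * (\<Sum>i\<in>{k..<q}. z i))"
  proof (rule sum.cong[OF refl])
    fix k
    have "{k..<q} = {i \<in> {..<q}. k \<le> i}" by auto
    then have "(\<Sum>i\<in>{k..<q}. z i * (w k - w (k - 1))) = (\<Sum>i<q. if k \<le> i then z i * (w k - w (k - 1)) else 0)"
      by (simp only: sum.inter_filter finite_lessThan)
    then show "(\<Sum>i<q. if k \<le> i then z i * (w k - w (k - 1)) else 0) = (w k - w (k - 1)) * (\<Sum>i\<in>{k..<q}. z i)"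
      by (simp only: sum_distrib_right mult.commute[of "w k - w (k - 1)"])
  qed
  finally show ?thesis .
qed

text \<open>Cauchy-Schwarz is applied to the first \<open>k\<close> and to the last
  \<open>q - k\<close> coordinates, whose sums are opposite; weighting the two bounds by
  \<open>q - k\<close> and \<open>k\<close> combines them into the full norm. The factor is the norm
  of the centred step vector.\<close>

lemma tail_sum_le:
  assumes w: "(\<Sum>i<q. w i) = 0" and k: "1 \<le> k" "k < q"
  shows "(\<Sum>i\<in>{k..<q}. w i) \<le> sqrt (real k * (real q - real k) / real q) * vnorm q w"
proof -
  define s where "s = (\<Sum>i\<in>{k..<q}. w i)"
  have split: "(\<Sum>i<q. f i) = (\<Sum>i<k. f i) + (\<Sum>i\<in>{k..<q}. f i)" for f :: "nat \<Rightarrow> real"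
    using k sum.atLeastLessThan_concat[of 0 k q f] by (simp add: lessThan_atLeast0)
  have head: "(\<Sum>i<k. w i) = - s" using w split[of w] by (simp add: s_def)
  have "s\<^sup>2 \<le> real k * (\<Sum>i<k. (w i)\<^sup>2)"
    using Cauchy_Schwarz_ineq_sum[of "\<lambda>_. 1" w "{..<k}"] head by simp
  moreover have "s\<^sup>2 \<le> (real q - real k) * (\<Sum>i\<in>{k..<q}. (w i)\<^sup>2)"
    using Cauchy_Schwarz_ineq_sum[of "\<lambda>_. 1" w "{k..<q}"] k by (simp add: s_def of_nat_diff)
  ultimately have "(real q - real k) * s\<^sup>2 + real k * s\<^sup>2
      \<le> (real q - real k) * (real k * (\<Sum>i<k. (w i)\<^sup>2)) + real k * ((real q - real k) * (\<Sum>i\<in>{k..<q}. (w i)\<^sup>2))"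
    using k by (intro add_mono mult_left_mono) auto
  also have "\<dots> = real k * (real q - real k) * dot q w w"
    by (simp add: dot_def split algebra_simps power2_eq_square)
  finally have "real q * s\<^sup>2 \<le> real k * (real q - real k) * dot q w w" by (simp add: algebra_simps)
  then have "s\<^sup>2 \<le> real k * (real q - real k) / real q * (vnorm q w)\<^sup>2"
    using k by (simp add: dot_self field_simps)
  also have "\<dots> = (sqrt (real k * (real q - real k) / real q) * vnorm q w)\<^sup>2"
    using k by (simp add: power_mult_distrib)
  finally show ?thesis
    unfolding s_def by (rule power2_le_imp_le) (use k in \<open>simp add: vnorm_nonneg\<close>)
qed

lemma b_coeff_q [simp]: "b_coeff q q = 0"
  and b_coeff_0 [simp]: "b_coeff q 0 = 0"
  by (simp_all add: b_coeff_def)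

text \<open>The first factor does not depend on \<open>k\<close> and the second is the one in
  \<open>tail_sum_le\<close>: this is the equal-angle property.\<close>

lemma b_coeff_eq:
  "b_coeff q k = sqrt (3 / (real q + 1)) * sqrt (real k * (real q - real k) / real q)"
  by (simp add: b_coeff_def mult_ac flip: real_sqrt_mult)

text \<open>With components numbered from 0, \<open>a_hat q i\<close> is
  \<open>b_coeff q i - b_coeff q (i + 1)\<close>, so the tail telescopes down to
  \<open>b_coeff q q = 0\<close>.\<close>

lemma a_hat_tail: "k \<le> q \<Longrightarrow> (\<Sum>i\<in>{k..<q}. a_hat q i) = b_coeff q k"
proof (induction "q - k" arbitrary: k)
  case 0
  then show ?case by simp
next
  case (Suc n)
  then have "k < q" by simp
  then have "(\<Sum>i\<in>{k..<q}. a_hat q i) = a_hat q k + (\<Sum>i\<in>{Suc k..<q}. a_hat q i)"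
    by (rule sum.atLeast_Suc_lessThan)
  also have "(\<Sum>i\<in>{Suc k..<q}. a_hat q i) = b_coeff q (Suc k)"
    using Suc by (intro Suc.hyps) auto
  finally show ?case using \<open>k < q\<close> by (simp add: a_hat_def a_coeff_def)
qed

lemma a_hat_Mtilde: "a_hat q \<in> Mtilde q"
  using a_hat_tail[of 0 q] by (auto simp: Mtilde_iff lessThan_atLeast0) (simp add: a_hat_def)

text \<open>Abel summation is used twice. With \<open>z = w\<close> it expresses the squared norm
  through tail sums of \<open>w\<close>, which \<open>tail_sum_le\<close> bounds; up to the factor
  \<kappa> these bounds are the tail sums of \<open>a_hat q\<close> times the norm, so Abel
  summation with \<open>z = a_hat q\<close> recognises the result. Sortedness makes the increments
  of \<open>w\<close> nonnegative.\<close>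

lemma dot_a_hat_ge:
  assumes w: "w \<in> Mtilde q" and s: "sorted_vec q w"
  shows "sqrt (3 / (real q + 1)) * vnorm q w \<le> dot q (a_hat q) w"
proof -
  define \<kappa> where "\<kappa> = sqrt (3 / (real q + 1))"
  have pos: "\<kappa> \<ge> 0" by (simp add: \<kappa>_def)
  have "\<kappa> * (vnorm q w)\<^sup>2 = \<kappa> * (\<Sum>k\<in>{1..<q}. (w k - w (k - 1)) * (\<Sum>i\<in>{k..<q}. w i))"
    using dot_Abel[where q = q and z = w and w = w] w by (simp add: Mtilde_iff flip: dot_self)
  also have "\<dots> \<le> \<kappa> * (\<Sum>k\<in>{1..<q}. (w k - w (k - 1)) * (sqrt (real k * (real q - real k) / real q) * vnorm q w))"
    using s w pos by (intro mult_left_mono sum_mono tail_sum_le) (auto simp: sorted_vec_def Mtilde_iff)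
  also have "\<dots> = (\<Sum>k\<in>{1..<q}. (w k - w (k - 1)) * (\<Sum>i\<in>{k..<q}. a_hat q i)) * vnorm q w"
    by (simp add: a_hat_tail b_coeff_eq \<kappa>_def sum_distrib_left sum_distrib_right mult_ac)
  also have "\<dots> = dot q (a_hat q) w * vnorm q w"
    using dot_Abel[where q = q and z = "a_hat q" and w = w] a_hat_Mtilde[of q] by (simp add: Mtilde_iff)
  finally have "\<kappa> * vnorm q w * vnorm q w \<le> dot q (a_hat q) w * vnorm q w"
    by (simp add: power2_eq_square mult.assoc)
  moreover have "dot q (a_hat q) w = 0" if "vnorm q w = 0"
    using that dot_eq_0_if_self[of q w] by (simp add: dot_self)
  ultimately show ?thesis
    using vnorm_nonneg[of q w] unfolding \<kappa>_def[symmetric] by (cases "vnorm q w = 0") auto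
qed

section \<open>Permutations and order of components\<close>

lemma dot_permute:
  assumes "p permutes {..<q}"
  shows "dot q (v \<circ> p) w = dot q v (w \<circ> inv p)"
proof -
  have "dot q v (w \<circ> inv p) = (\<Sum>i\<in>{..<q}. v (p i) * w (inv p (p i)))"
    unfolding dot_def using sum.permute[OF assms, of "\<lambda>i. v i * (w \<circ> inv p) i"] by (simp add: o_def)
  then show ?thesis using permutes_inverses(2)[OF assms] by (simp add: dot_def)
qed

lemma permute_Mtilde:
  assumes p: "p permutes {..<q}" and w: "w \<in> Mtilde q"
  shows "w \<circ> p \<in> Mtilde q" "vnorm q (w \<circ> p) = vnorm q w"
proof -
  have "(\<Sum>i<q. (w \<circ> p) i) = (\<Sum>i<q. w i)"
    using sum.permute[OF p, of w] by simp
  then show "w \<circ> p \<in> Mtilde q" using w p by (auto simp: Mtilde_iff permutes_def)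
  have "(\<Sum>i<q. ((w \<circ> p) i)\<^sup>2) = (\<Sum>i<q. (w i)\<^sup>2)"
    using sum.permute[OF p, of "\<lambda>i. (w i)\<^sup>2"] by (simp add: o_def)
  then show "vnorm q (w \<circ> p) = vnorm q w" by (simp add: vnorm_def L2_set_def)
qed

lemma ex_sorting_permutation:
  obtains p where "p permutes {..<q}" "sorted_vec q (w \<circ> p)"
proof -
  define xs where "xs = map w [0..<q]"
  have "mset (sort xs) = mset xs" by simp
  then obtain p where p: "p permutes {..<length xs}" "permute_list p xs = sort xs"
    by (metis mset_eq_permutation)
  have len: "length xs = q" by (simp add: xs_def)
  have "(w \<circ> p) i = sort xs ! i" if "i < q" for i
  proof -
    have "p i < q" using p(1) that permutes_in_image[OF p(1), of i] by (simp add: len)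
    then show ?thesis using permute_list_nth[OF p(1), of i] that p(2) by (simp add: len) (simp add: xs_def)
  qed
  moreover have "sort xs ! i \<le> sort xs ! j" if "i \<le> j" "j < q" for i j
    using that len by (intro sorted_nth_mono) auto
  ultimately have "sorted_vec q (w \<circ> p)" by (simp add: sorted_vec_def)
  then show ?thesis using that p(1) len by metis
qed

text \<open>The square root of the concave quadratic k (q - k) is concave in \<open>k\<close>, and
  concavity of \<open>b_coeff q\<close> says that its successive decreases grow.\<close>

lemma a_hat_sorted: "sorted_vec q (a_hat q)"
proof -
  have step: "a_hat q i \<le> a_hat q (Suc i)" if "Suc i < q" for i
  proof -
    define k where "k = Suc i"
    have k: "1 \<le> k" "k < q" using that by (simp_all add: k_def)
    define X where "X = 3 * real (k - 1) * (real q - real (k - 1)) / (real q * (real q + 1))"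
    define Y where "Y = 3 * real (k + 1) * (real q - real (k + 1)) / (real q * (real q + 1))"
    define Z where "Z = 3 * real k * (real q - real k) / (real q * (real q + 1))"
    have b: "b_coeff q (k - 1) = sqrt X" "b_coeff q (k + 1) = sqrt Y" "b_coeff q k = sqrt Z"
      by (simp_all add: b_coeff_def X_def Y_def Z_def)
    have nn: "X \<ge> 0" "Y \<ge> 0" "Z \<ge> 0" using k by (auto simp: X_def Y_def Z_def)
    have "X + Y \<le> 2 * Z"
      unfolding X_def Y_def Z_def times_divide_eq_right add_divide_distrib[symmetric]
      using k by (intro divide_right_mono) (auto simp: of_nat_diff algebra_simps)
    moreover have "(sqrt X + sqrt Y)\<^sup>2 \<le> 2 * (X + Y)"
      using sum_squares_bound[of "sqrt X" "sqrt Y"] nn by (simp add: power2_sum)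
    ultimately have "(sqrt X + sqrt Y)\<^sup>2 \<le> (2 * sqrt Z)\<^sup>2" using nn by (simp add: power_mult_distrib)
    then have "sqrt X + sqrt Y \<le> 2 * sqrt Z" by (rule power2_le_imp_le) (simp add: nn)
    then show ?thesis using k b by (simp add: a_hat_def a_coeff_def k_def)
  qed
  have "i \<le> j \<Longrightarrow> j < q \<Longrightarrow> a_hat q i \<le> a_hat q j" for i j
    by (induction j rule: nat_induct_at_least[of i]) (auto intro: order_trans step)
  then show ?thesis by (simp add: sorted_vec_def)
qed

lemma vnorm_a_hat_pos:
  assumes "2 \<le> q" shows "0 < vnorm q (a_hat q)"
proof -
  have "b_coeff q 1 > 0" using assms by (simp add: b_coeff_def)
  then have "a_hat q 0 \<noteq> 0" using assms by (simp add: a_hat_def a_coeff_def)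
  then have "a_hat q \<noteq> (\<lambda>i. 0)" by auto
  then have "vnorm q (a_hat q) \<noteq> 0" using a_hat_Mtilde[of q] by (subst vnorm_eq_0) (auto simp: Mtilde_iff)
  then show ?thesis using vnorm_nonneg[of q "a_hat q"] by simp
qed

definition y_scale :: "nat \<Rightarrow> real" where
  "y_scale q = sqrt (real q * ((real q)\<^sup>2 - 1) / 12) / vnorm q (a_hat q)"

lemma y_hat_eq: "y_hat q = (\<lambda>i. y_scale q * a_hat q i)"
  by (simp add: y_hat_def y_scale_def)

lemma y_scale_pos: "2 \<le> q \<Longrightarrow> 0 < y_scale q"
proof -
  assume q: "2 \<le> q"
  then have "1 < (real q)\<^sup>2" by (intro one_less_power) auto
  then show ?thesis unfolding y_scale_def using q vnorm_a_hat_pos[OF q] by simp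
qed

lemma y_hat_Mtilde: "y_hat q \<in> Mtilde q"
  unfolding y_hat_eq using Mtilde_lin[OF a_hat_Mtilde a_hat_Mtilde, where a = "y_scale q" and b = 0] by simp

lemma y_hat_sorted:
  assumes "2 \<le> q" shows "sorted_vec q (y_hat q)"
  using a_hat_sorted[of q] y_scale_pos[OF assms] by (simp add: sorted_vec_def y_hat_eq)

lemma vnorm_y_hat:
  assumes "2 \<le> q" shows "vnorm q (y_hat q) = y_scale q * vnorm q (a_hat q)" "0 < vnorm q (y_hat q)"
  using y_scale_pos[OF assms] vnorm_a_hat_pos[OF assms] by (simp_all add: y_hat_eq vnorm_scale)

text \<open>Sorting \<open>w\<close> by \<open>p\<close> has the same effect on the inner product as
  applying \<open>inv p\<close> to \<open>y_hat q\<close>, so the bound for sorted vectors reaches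
  every \<open>w\<close>.\<close>

lemma orbit_y_hat_reaches:
  assumes q: "2 \<le> q" and w: "w \<in> Mtilde q"
  obtains y where "y \<in> perm_orbit q (y_hat q)"
    "y_scale q * sqrt (3 / (real q + 1)) * vnorm q w \<le> dot q y w"
proof -
  obtain p where p: "p permutes {..<q}" "sorted_vec q (w \<circ> p)" by (rule ex_sorting_permutation)
  have ip: "inv p permutes {..<q}" by (rule permutes_inv[OF p(1)])
  have "y_scale q * sqrt (3 / (real q + 1)) * vnorm q w \<le> y_scale q * dot q (a_hat q) (w \<circ> p)"
    using dot_a_hat_ge[OF permute_Mtilde(1)[OF p(1) w] p(2)] permute_Mtilde(2)[OF p(1) w] y_scale_pos[OF q]
    by simp
  also have "\<dots> = dot q (y_hat q) (w \<circ> p)" by (simp add: y_hat_eq dot_scale_left)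
  also have "\<dots> = dot q (y_hat q \<circ> inv p) w"
    by (simp add: dot_permute[OF ip] permutes_inv_inv[OF p(1)])
  finally show ?thesis using that ip by (auto simp: perm_orbit_def)
qed

section \<open>Empty caps\<close>

lemma measure_empty_cap_le:
  assumes q: "2 \<le> q" and C: "C \<in> spherical_caps q (vnorm q (y_hat q))" "perm_orbit q (y_hat q) \<inter> C = {}"
  shows "measure (uniform_sphere q (vnorm q (y_hat q))) C
    \<le> (real q + 1) * (vnorm q (a_hat q))\<^sup>2 / (3 * (real q - 1))"
proof -
  define \<rho> where "\<rho> = vnorm q (y_hat q)"
  define U where "U = uniform_sphere q \<rho>"
  define s where "s = sqrt (3 / (real q + 1))"
  have \<rho>: "0 < \<rho>" unfolding \<rho>_def by (rule vnorm_y_hat(2)[OF q])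
  have U: "invariant_prob q \<rho> U" unfolding U_def by (rule invariant_prob_uniform_sphere[OF q \<rho>])
  interpret prob_space U using U by (simp add: invariant_prob_def)
  obtain w t where w: "w \<in> Stilde q \<rho>" and Cw: "C = cap q \<rho> w t"
    using C(1) by (auto simp: spherical_caps_def \<rho>_def)
  have wM: "w \<in> Mtilde q" and ww: "dot q w w = \<rho>\<^sup>2" and wn: "vnorm q w = \<rho>"
    using w by (auto simp: Stilde_def dot_self)
  define c where "c = y_scale q * s * \<rho>"
  have c: "0 < c" using y_scale_pos[OF q] \<rho> by (simp add: c_def s_def)
  obtain y where y: "y \<in> perm_orbit q (y_hat q)" "c \<le> dot q y w"
    using orbit_y_hat_reaches[OF q wM] unfolding wn c_def s_def by blast
  have "y \<in> Stilde q \<rho>"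
    using y(1) permute_Mtilde[OF _ y_hat_Mtilde] by (auto simp: perm_orbit_def Stilde_def \<rho>_def)
  \<comment> \<open>The orbit point \<open>y\<close> is not in the cap, so the threshold of the cap
    is at least \<open>c\<close>.\<close>
  then have "dot q y w \<le> \<rho>\<^sup>2 * t" using C(2) y(1) unfolding Cw by (auto simp: cap_def)
  then have sub: "C \<subseteq> {v \<in> Stilde q \<rho>. dot q v w > c}" using y(2) by (auto simp: Cw cap_def)
  have sets: "{v \<in> Stilde q \<rho>. dot q v w > c} \<in> sets U"
  proof -
    have "{v \<in> space borel. dot q v w > c} \<in> sets borel" by measurable
    then show ?thesis
      unfolding sets_invariant_prob[OF U] sets_restrict_space by auto
  qed
  have "measure U C \<le> measure U {v \<in> Stilde q \<rho>. dot q v w > c}"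
    by (rule finite_measure_mono[OF sub sets])
  also have "\<dots> \<le> \<rho>\<^sup>2 * dot q w w / ((real q - 1) * c\<^sup>2)"
    by (rule measure_cap_le[OF U \<rho> q wM c])
  also have "\<dots> = (real q + 1) * (vnorm q (a_hat q))\<^sup>2 / (3 * (real q - 1))"
  proof -
    have "\<rho> = y_scale q * vnorm q (a_hat q)" unfolding \<rho>_def by (rule vnorm_y_hat(1)[OF q])
    moreover have "s\<^sup>2 = 3 / (real q + 1)" by (simp add: s_def)
    ultimately show ?thesis
      using y_scale_pos[OF q] \<rho> q by (simp add: ww c_def power_mult_distrib) (simp add: field_simps)
  qed
  finally show ?thesis by (simp add: U_def \<rho>_def)
qed

text \<open>Ensures that the supremum in \<open>largest_empty_cap\<close> ranges over a nonempty
  set. Around a point of the sphere outside \<open>N\<close> a sufficiently small cap avoids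
  \<open>N\<close>.\<close>

lemma ex_empty_cap:
  assumes q: "3 \<le> q" and N: "finite N" "N \<subseteq> Stilde q \<rho>" and \<rho>: "0 < \<rho>"
  shows "\<exists>C \<in> spherical_caps q \<rho>. N \<inter> C = {}"
proof -
  \<comment> \<open>The new point is told apart from \<open>N\<close> by its coordinate 0, which has
    infinitely many admissible values.\<close>
  have "infinite ({0<..<\<rho> / 2} - (\<lambda>v. v 0) ` N)"
    using N(1) \<rho> by (intro Diff_infinite_finite) auto
  then obtain s where s: "0 < s" "s < \<rho> / 2" "s \<notin> (\<lambda>v. v 0) ` N"
    by (metis DiffE finite.emptyI greaterThanLessThan_iff all_not_in_conv)
  \<comment> \<open>Makes the vector with components \<open>s\<close>, \<open>r - s/2\<close>,
    \<open>- r - s/2\<close> have squared norm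
    \<open>2 * r\<^sup>2 + 3/2 * s\<^sup>2 = \<rho>\<^sup>2\<close>; the bound s < \<rho>/2 keeps
    the radicand nonnegative.\<close>
  define r where "r = sqrt ((\<rho>\<^sup>2 - 3 / 2 * s\<^sup>2) / 2)"
  have "s\<^sup>2 \<le> (\<rho> / 2)\<^sup>2" using s by (intro power_mono) auto
  then have "4 * s\<^sup>2 \<le> \<rho>\<^sup>2" by (simp add: power_divide)
  moreover have "0 \<le> s\<^sup>2" by simp
  ultimately have "3 * s\<^sup>2 \<le> 2 * \<rho>\<^sup>2" by linarith
  then have "0 \<le> (\<rho>\<^sup>2 - 3 / 2 * s\<^sup>2) / 2" by simp
  then have r: "2 * r\<^sup>2 = \<rho>\<^sup>2 - 3 / 2 * s\<^sup>2" unfolding r_def by (subst real_sqrt_pow2) simp_all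
  define w where "w = (\<lambda>i::nat. if i = 0 then s else if i = 1 then r - s / 2 else if i = 2 then - r - s / 2 else 0)"
  have sum3: "(\<Sum>i<q. f i) = f 0 + f 1 + f 2" if "\<And>i. i \<ge> 3 \<Longrightarrow> f i = 0" for f :: "nat \<Rightarrow> real"
  proof -
    have "(\<Sum>i<q. f i) = (\<Sum>i<3. f i)"
      using q that by (intro sum.mono_neutral_right) auto
    then show ?thesis by (simp add: eval_nat_numeral)
  qed
  have "(\<Sum>i<q. w i) = 0" by (subst sum3) (auto simp: w_def)
  then have "w \<in> Mtilde q" using q by (auto simp: Mtilde_iff w_def)
  moreover have "dot q w w = \<rho>\<^sup>2"
    unfolding dot_def using r by (subst sum3) (auto simp: w_def power2_eq_square algebra_simps)
  ultimately have w: "w \<in> Stilde q \<rho>" using \<rho> by (simp add: Stilde_iff)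
  have lt: "dot q v w < \<rho>\<^sup>2" if "v \<in> N" for v
  proof -
    have v: "v \<in> Stilde q \<rho>" using that N by auto
    have "v 0 \<noteq> w 0" using s(3) that by (auto simp: w_def)
    then have "dot q (\<lambda>i. v i - w i) (\<lambda>i. v i - w i) \<noteq> 0"
      unfolding dot_self_eq_0 using q by (auto intro!: exI[of _ 0])
    then have "0 < dot q (\<lambda>i. v i - w i) (\<lambda>i. v i - w i)"
      using dot_self_nonneg[of q "\<lambda>i. v i - w i"] by linarith
    then show ?thesis using v w by (simp add: dot_simps Stilde_iff[OF \<rho>] dot_commute[of q w v])
  qed
  \<comment> \<open>The value -1 is inserted to keep the threshold in the range of
    \<open>spherical_caps\<close>, also for empty \<open>N\<close>.\<close>
  define t where "t = Max (insert (-1) ((\<lambda>v. dot q v w / \<rho>\<^sup>2) ` N))"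
  have t: "-1 \<le> t" "t < 1"
    using N(1) lt \<rho> by (auto simp: t_def)
  have "N \<inter> cap q \<rho> w t = {}"
  proof -
    have "dot q v w \<le> \<rho>\<^sup>2 * t" if "v \<in> N" for v
    proof -
      have "dot q v w / \<rho>\<^sup>2 \<le> t" unfolding t_def using N(1) that by (intro Max_ge) auto
      then show ?thesis using \<rho> by (simp add: field_simps)
    qed
    then show ?thesis by (force simp: cap_def)
  qed
  then show ?thesis using w t by (auto simp: spherical_caps_def)
qed

lemma largest_empty_cap_y_hat:
  assumes q: "3 \<le> q"
  shows "0 \<le> largest_empty_cap q (vnorm q (y_hat q)) (perm_orbit q (y_hat q))"
    and "largest_empty_cap q (vnorm q (y_hat q)) (perm_orbit q (y_hat q))
      \<le> (real q + 1) * (vnorm q (a_hat q))\<^sup>2 / (3 * (real q - 1))"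
proof -
  have q2: "2 \<le> q" using q by simp
  define E where "E = {C \<in> spherical_caps q (vnorm q (y_hat q)). perm_orbit q (y_hat q) \<inter> C = {}}"
  have "finite (perm_orbit q (y_hat q))"
    unfolding perm_orbit_def using finite_permutations[of "{..<q}"] by (simp add: setcompr_eq_image)
  moreover have "perm_orbit q (y_hat q) \<subseteq> Stilde q (vnorm q (y_hat q))"
    using permute_Mtilde[OF _ y_hat_Mtilde] by (auto simp: perm_orbit_def Stilde_def)
  ultimately have "\<exists>C \<in> spherical_caps q (vnorm q (y_hat q)). perm_orbit q (y_hat q) \<inter> C = {}"
    by (rule ex_empty_cap[OF q _ _ vnorm_y_hat(2)[OF q2]])
  then have ne: "E \<noteq> {}" by (auto simp: E_def)
  have le: "measure (uniform_sphere q (vnorm q (y_hat q))) C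
    \<le> (real q + 1) * (vnorm q (a_hat q))\<^sup>2 / (3 * (real q - 1))" if "C \<in> E" for C
    using that measure_empty_cap_le[OF q2] by (simp add: E_def)
  show "largest_empty_cap q (vnorm q (y_hat q)) (perm_orbit q (y_hat q))
      \<le> (real q + 1) * (vnorm q (a_hat q))\<^sup>2 / (3 * (real q - 1))"
    unfolding largest_empty_cap_def E_def[symmetric] using ne le by (rule cSUP_least)
  obtain C where C: "C \<in> E" using ne by auto
  have "0 \<le> measure (uniform_sphere q (vnorm q (y_hat q))) C" by simp
  also have "\<dots> \<le> largest_empty_cap q (vnorm q (y_hat q)) (perm_orbit q (y_hat q))"
    unfolding largest_empty_cap_def E_def[symmetric] using le C by (intro cSUP_upper bdd_aboveI2) auto
  finally show "0 \<le> largest_empty_cap q (vnorm q (y_hat q)) (perm_orbit q (y_hat q))" .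
qed

section \<open>The norm of a\<close>

lemma sqrt_diff_square_le:
  assumes "0 \<le> A" "0 < B" shows "(sqrt A - sqrt B)\<^sup>2 \<le> (A - B)\<^sup>2 / B"
proof -
  have "(A - B)\<^sup>2 = (sqrt A - sqrt B)\<^sup>2 * (sqrt A + sqrt B)\<^sup>2"
    using assms by (simp add: power_mult_distrib[symmetric] algebra_simps)
  moreover have "(sqrt B)\<^sup>2 \<le> (sqrt A + sqrt B)\<^sup>2"
    using assms by (intro power_mono) auto
  ultimately have "(sqrt A - sqrt B)\<^sup>2 * B \<le> (A - B)\<^sup>2"
    using assms by (simp add: mult_left_mono)
  then show ?thesis using assms by (simp add: field_simps)
qed

text \<open>A crude bound for the logarithmically growing harmonic sum, obtained by telescoping
  1/(n+1) \<le> 2 (sqrt (n+1) - sqrt n). It still leaves a final estimate of order 1/sqrt q.\<close>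

lemma sum_inverse_le: "(\<Sum>k\<in>{1..n}. 1 / real k) \<le> 2 * sqrt (real n)"
proof (induction n)
  case (Suc n)
  have "sqrt (real n) * sqrt (real (Suc n)) \<le> real n + 1 / 2"
  proof (rule power2_le_imp_le)
    show "(sqrt (real n) * sqrt (real (Suc n)))\<^sup>2 \<le> (real n + 1 / 2)\<^sup>2"
      by (simp add: power_mult_distrib power2_eq_square algebra_simps)
  qed simp
  then have "1 \<le> 2 * real (Suc n) - 2 * (sqrt (real n) * sqrt (real (Suc n)))" by simp
  also have "\<dots> = (2 * sqrt (real (Suc n)) - 2 * sqrt (real n)) * sqrt (real (Suc n))"
    by (simp add: algebra_simps del: of_nat_Suc)
  also have "\<dots> \<le> (2 * sqrt (real (Suc n)) - 2 * sqrt (real n)) * real (Suc n)"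
  proof (rule mult_left_mono)
    have "real (Suc n) * 1 \<le> real (Suc n) * real (Suc n)" by (intro mult_left_mono) auto
    then show "sqrt (real (Suc n)) \<le> real (Suc n)"
      by (intro real_le_lsqrt) (auto simp: power2_eq_square)
  qed simp
  finally have "1 / real (Suc n) \<le> 2 * sqrt (real (Suc n)) - 2 * sqrt (real n)"
    by (simp add: pos_divide_le_eq del: of_nat_Suc)
  then show ?case using Suc by simp
qed simp

text \<open>Consecutive values of k (q - k) differ by at most \<open>q\<close>, so a squared
  difference of consecutive \<open>b_coeff\<close> values is at most \<open>C\<close> times q^2 / (k
  (q - k)); partial fractions turn the sum over \<open>k\<close> into two harmonic sums.\<close>

lemma vnorm_a_hat_le:
  assumes q: "2 \<le> q"
  shows "(vnorm q (a_hat q))\<^sup>2 \<le> 3 * (1 + 4 * sqrt (real q)) / (real q + 1)"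
proof -
  define C where "C = 3 / (real q * (real q + 1))"
  have C: "C > 0" using q by (simp add: C_def)
  have step: "(b_coeff q (k - 1) - b_coeff q k)\<^sup>2 \<le> C * real q * (1 / real k + 1 / real (q - k))"
    if k: "k \<in> {1..<q}" for k
  proof -
    define A where "A = real (k - 1) * (real q - real (k - 1))"
    define B where "B = real k * (real q - real k)"
    have b: "b_coeff q (k - 1) = sqrt (C * A)" "b_coeff q k = sqrt (C * B)"
      by (simp_all add: b_coeff_def A_def B_def C_def mult_ac)
    have B: "0 < B" using k by (simp add: B_def)
    have A: "0 \<le> A" using k by (simp add: A_def)
    have "\<bar>A - B\<bar> \<le> real q"
    proof -
      have "A - B = 2 * real k - 1 - real q" using k by (simp add: A_def B_def of_nat_diff algebra_simps)
      then show ?thesis using k by auto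
    qed
    then have AB: "(A - B)\<^sup>2 \<le> (real q)\<^sup>2" using abs_le_square_iff[of "A - B" "real q"] by simp
    have "(b_coeff q (k - 1) - b_coeff q k)\<^sup>2 = C * (sqrt A - sqrt B)\<^sup>2"
      unfolding b real_sqrt_mult right_diff_distrib[symmetric] using C by (simp add: power_mult_distrib)
    also have "\<dots> \<le> C * ((A - B)\<^sup>2 / B)"
      using C sqrt_diff_square_le[OF A B] by (intro mult_left_mono) auto
    also have "\<dots> \<le> C * ((real q)\<^sup>2 / B)"
      using C B AB by (intro mult_left_mono divide_right_mono) auto
    also have "(real q)\<^sup>2 / B = real q * (1 / real k + 1 / real (q - k))"
      using k by (simp add: B_def of_nat_diff field_simps power2_eq_square)
    finally show ?thesis by (simp add: mult.assoc)
  qed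
  have "(\<Sum>k\<in>{1..<q}. 1 / real (q - k)) = (\<Sum>k\<in>{1..<q}. 1 / real k)"
    using sum.atLeastLessThan_rev[of "\<lambda>k. 1 / real k" 1 q] by simp
  moreover have "(\<Sum>k\<in>{1..<q}. 1 / real k) \<le> 2 * sqrt (real q)"
  proof -
    have "(\<Sum>k\<in>{1..<q}. 1 / real k) \<le> (\<Sum>k\<in>{1..q}. 1 / real k)"
      by (intro sum_mono2) auto
    then show ?thesis using sum_inverse_le[of q] by linarith
  qed
  ultimately have inv: "(\<Sum>k\<in>{1..<q}. 1 / real k + 1 / real (q - k)) \<le> 4 * sqrt (real q)"
    by (simp add: sum.distrib)
  have "(vnorm q (a_hat q))\<^sup>2 = (\<Sum>i<q. (b_coeff q i - b_coeff q (Suc i))\<^sup>2)"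
    unfolding dot_self[symmetric] dot_def
    by (intro sum.cong) (auto simp: a_hat_def a_coeff_def power2_eq_square)
  also have "\<dots> = (\<Sum>k\<in>{1..q}. (b_coeff q (k - 1) - b_coeff q k)\<^sup>2)"
    using sum.atLeast_Suc_atMost_Suc_shift[of "\<lambda>k. (b_coeff q (k - 1) - b_coeff q k)\<^sup>2" 0 "q - 1"] q
    by (simp add: atLeast0AtMost lessThan_Suc_atMost[symmetric])
  \<comment> \<open>The term for \<open>k = q\<close> is treated separately, because there the
    divisor k (q - k) is 0.\<close>
  also have "\<dots> = (\<Sum>k\<in>{1..<q}. (b_coeff q (k - 1) - b_coeff q k)\<^sup>2) + (b_coeff q (q - 1))\<^sup>2"
    using q by (simp add: sum.last_plus)
  also have "\<dots> \<le> (\<Sum>k\<in>{1..<q}. C * real q * (1 / real k + 1 / real (q - k))) + C * real q"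
  proof (intro add_mono sum_mono step)
    have "(b_coeff q (q - 1))\<^sup>2 = C * (real q - 1)"
      using q by (simp add: b_coeff_def C_def of_nat_diff)
    also have "\<dots> \<le> C * real q" using C by simp
    finally show "(b_coeff q (q - 1))\<^sup>2 \<le> C * real q" .
  qed auto
  also have "\<dots> = C * real q * (1 + (\<Sum>k\<in>{1..<q}. 1 / real k + 1 / real (q - k)))"
    by (simp add: distrib_left sum_distrib_left)
  also have "\<dots> \<le> C * real q * (1 + 4 * sqrt (real q))"
    using C inv by (intro mult_left_mono) auto
  also have "\<dots> = 3 * (1 + 4 * sqrt (real q)) / (real q + 1)"
    using q by (simp add: C_def)
  finally show ?thesis .
qed

lemma APF_centered_y_hat: "APF_centered y_hat"
proof -
  have "y_hat q \<in> Mtilde_le q \<and> y_hat q \<noteq> (\<lambda>i. 0)" if "q \<ge> 3" for q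
  proof -
    have "y_hat q \<noteq> (\<lambda>i. 0)" using vnorm_y_hat(2)[of q] vnorm_eq_0[of q "y_hat q"] that by fastforce
    then show ?thesis using that y_hat_Mtilde y_hat_sorted[of q] by (simp add: Mtilde_le_def)
  qed
  moreover have "(\<lambda>q. largest_empty_cap q (vnorm q (y_hat q)) (perm_orbit q (y_hat q))) \<longlonglongrightarrow> 0"
  proof (rule tendsto_sandwich[OF _ _ tendsto_const])
    show "\<forall>\<^sub>F q in sequentially. 0 \<le> largest_empty_cap q (vnorm q (y_hat q)) (perm_orbit q (y_hat q))"
      using eventually_ge_at_top[of 3] by eventually_elim (rule largest_empty_cap_y_hat(1))
    show "\<forall>\<^sub>F q in sequentially. largest_empty_cap q (vnorm q (y_hat q)) (perm_orbit q (y_hat q))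
        \<le> (1 + 4 * sqrt (real q)) / (real q - 1)"
      using eventually_ge_at_top[of 3]
    proof eventually_elim
      case (elim q)
      have "(real q + 1) * (vnorm q (a_hat q))\<^sup>2 / (3 * (real q - 1))
          \<le> (real q + 1) * (3 * (1 + 4 * sqrt (real q)) / (real q + 1)) / (3 * (real q - 1))"
        using vnorm_a_hat_le[of q] elim by (intro divide_right_mono mult_left_mono) auto
      also have "\<dots> = (1 + 4 * sqrt (real q)) / (real q - 1)"
        using elim by (simp add: divide_simps) (simp add: algebra_simps)
      finally show ?case using largest_empty_cap_y_hat(2)[OF elim] by linarith
    qed
    show "(\<lambda>q. (1 + 4 * sqrt (real q)) / (real q - 1)) \<longlonglongrightarrow> 0" by real_asymp
  qed
  ultimately show ?thesis by (auto simp: APF_centered_def)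
qed

lemma center_x_hat: "center q (x_hat q) = y_hat q"
proof -
  have "(\<Sum>j<q. x_hat q j) = real q * ((real q + 1) / 2)"
    using y_hat_Mtilde[of q] by (simp add: x_hat_def sum.distrib Mtilde_iff) (simp add: evec_def)
  then show ?thesis by (auto simp: center_def x_hat_def evec_def)
qed

theorem proposition4p5:
  shows "APF_centered y_hat \<and> APF x_hat"
proof
  show "APF_centered y_hat" by (rule APF_centered_y_hat)
  have "x_hat q \<in> topspace (Euclidean_space q) \<and> sorted_vec q (x_hat q) \<and> (\<exists>i<q. \<exists>j<q. x_hat q i \<noteq> x_hat q j)"
    if q: "q \<ge> 3" for q
  proof (intro conjI)
    show "x_hat q \<in> topspace (Euclidean_space q)"
      using y_hat_Mtilde[of q] by (simp add: mem_Euclidean_space_iff Mtilde_iff x_hat_def evec_def)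
    show "sorted_vec q (x_hat q)"
      using y_hat_sorted[of q] q by (simp add: sorted_vec_def x_hat_def evec_def)
    \<comment> \<open>Equal components would make \<open>y_hat q\<close> constant with sum 0, hence
      zero, against its positive norm.\<close>
    show "\<exists>i<q. \<exists>j<q. x_hat q i \<noteq> x_hat q j"
    proof (rule ccontr)
      assume "\<not> ?thesis"
      then have all: "\<forall>i<q. \<forall>j<q. x_hat q i = x_hat q j" by blast
      have eq: "y_hat q i = y_hat q 0" if i: "i < q" for i
      proof -
        have "x_hat q i = x_hat q 0" using all[rule_format, OF i, of 0] i by linarith
        then show ?thesis using i by (simp add: x_hat_def evec_def)
      qed
      have "(\<Sum>i<q. y_hat q i) = (\<Sum>i<q. y_hat q 0)" by (intro sum.cong eq) auto
      then have "y_hat q 0 = 0" using y_hat_Mtilde[of q] q by (simp add: Mtilde_iff)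
      then have "dot q (y_hat q) (y_hat q) = 0" using eq unfolding dot_self_eq_0 by metis
      then show False using vnorm_y_hat(2)[of q] q by (simp add: dot_self)
    qed
  qed
  then show "APF x_hat"
    unfolding APF_def center_x_hat using APF_centered_y_hat by blast
qed

end
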